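(* Let $X$ be a cocommutative coalgebra with counit over a field $k$, with comultiplication $\Delta$. Suppose $q:X\otimes X\to X$ is a self-distributive linear map that is compatible with comultiplication. Then the induced map $R_q=(1_X\otimes q)(\tau\otimes 1_X)(1_X\otimes\Delta):X\otimes X\to X\otimes X$ is a solution to the Yang--Baxter equation $$(R_q\otimes 1)(1\otimes R_q)(R_q\otimes 1)=(1\otimes R_q)(R_q\otimes 1)(1\otimes R_q).$$
   Context: $\tau(u\otimes v)=v\otimes u$ is the flip and $1$ inside composites is the identity map. $q$ is self-distributive if $q(q\otimes 1)=q(q\otimes q)(1\otimes\tau\otimes 1)(1\otimes 1\otimes\Delta)$ on $X^{\otimes 3}$; $q$ is compatible with comultiplication if $\Delta q=(q\otimes q)(1\otimes\tau\otimes 1)(\Delta\otimes\Delta)$. ($q$ is not required to be compatible with the counit, and "solution to the Yang--Baxter equation" means that the displayed equation holds.) *)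

theory Defs
  imports "HOL-Algebra.Module" "HOL-Algebra.AbelCoset"
begin

section \<open>Linear maps and quotient modules\<close>

definition linear_hom ::
  "('k, 'm) ring_scheme \<Rightarrow> ('k, 'a, 'p) module_scheme \<Rightarrow> ('k, 'b, 'q) module_scheme \<Rightarrow> ('a \<Rightarrow> 'b) set"
  where "linear_hom K M N =
    {f \<in> hom (add_monoid M) (add_monoid N).
       \<forall>a\<in>carrier K. \<forall>x\<in>carrier M. f (a \<odot>\<^bsub>M\<^esub> x) = a \<odot>\<^bsub>N\<^esub> f x}"

text \<open>In the module records below the ring fields \<open>mult\<close> and \<open>one\<close> play no role, as
  in the library locale \<^locale>\<open>module\<close>.\<close>

definition quotient_module ::
  "('k, 'a, 'p) module_scheme \<Rightarrow> 'a set \<Rightarrow> ('k, 'a set) module"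
  where "quotient_module M H =
    \<lparr>carrier = a_rcosets\<^bsub>M\<^esub> H, mult = undefined, one = undefined,
     zero = H, add = set_add M,
     smult = (\<lambda>a S. \<Union>s\<in>S. H +>\<^bsub>M\<^esub> (a \<odot>\<^bsub>M\<^esub> s))\<rparr>"

definition self_module :: "('k, 'm) ring_scheme \<Rightarrow> ('k, 'k) module"
  where "self_module K =
    \<lparr>carrier = carrier K, mult = mult K, one = one K, zero = zero K, add = add K,
     smult = mult K\<rparr>"


section \<open>Tensor products of modules\<close>

text \<open>The tensor product of \<open>M\<close> and \<open>N\<close> is the quotient of the free module on
  \<open>carrier M \<times> carrier N\<close> by the submodule generated by the bilinearity relations.
  Elements of the free module on \<open>I\<close> are represented by finitely supported functions that
  vanish outside \<open>I\<close>.\<close>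

definition free_module :: "('k, 'm) ring_scheme \<Rightarrow> 'i set \<Rightarrow> ('k, 'i \<Rightarrow> 'k) module"
  where "free_module K I =
    \<lparr>carrier = {f. (\<forall>i\<in>I. f i \<in> carrier K) \<and> (\<forall>i. i \<notin> I \<longrightarrow> f i = \<zero>\<^bsub>K\<^esub>)
                  \<and> finite {i. f i \<noteq> \<zero>\<^bsub>K\<^esub>}},
     mult = undefined, one = undefined,
     zero = (\<lambda>i. \<zero>\<^bsub>K\<^esub>), add = (\<lambda>f g i. f i \<oplus>\<^bsub>K\<^esub> g i),
     smult = (\<lambda>a f i. a \<otimes>\<^bsub>K\<^esub> f i)\<rparr>"

definition free_gen :: "('k, 'm) ring_scheme \<Rightarrow> 'i \<Rightarrow> 'i \<Rightarrow> 'k"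
  where "free_gen K i = (\<lambda>j. if j = i then \<one>\<^bsub>K\<^esub> else \<zero>\<^bsub>K\<^esub>)"

definition tensor_rels ::
  "('k, 'm) ring_scheme \<Rightarrow> ('k, 'a, 'p) module_scheme \<Rightarrow> ('k, 'b, 'q) module_scheme
    \<Rightarrow> ('a \<times> 'b \<Rightarrow> 'k) set"
  where "tensor_rels K M N =
    (let F = free_module K (carrier M \<times> carrier N); e = free_gen K in
      {e (x \<oplus>\<^bsub>M\<^esub> x', y) \<ominus>\<^bsub>F\<^esub> (e (x, y) \<oplus>\<^bsub>F\<^esub> e (x', y)) | x x' y.
         x \<in> carrier M \<and> x' \<in> carrier M \<and> y \<in> carrier N}
    \<union> {e (x, y \<oplus>\<^bsub>N\<^esub> y') \<ominus>\<^bsub>F\<^esub> (e (x, y) \<oplus>\<^bsub>F\<^esub> e (x, y')) | x y y'.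
         x \<in> carrier M \<and> y \<in> carrier N \<and> y' \<in> carrier N}
    \<union> {e (a \<odot>\<^bsub>M\<^esub> x, y) \<ominus>\<^bsub>F\<^esub> a \<odot>\<^bsub>F\<^esub> e (x, y) | a x y.
         a \<in> carrier K \<and> x \<in> carrier M \<and> y \<in> carrier N}
    \<union> {e (x, a \<odot>\<^bsub>N\<^esub> y) \<ominus>\<^bsub>F\<^esub> a \<odot>\<^bsub>F\<^esub> e (x, y) | a x y.
         a \<in> carrier K \<and> x \<in> carrier M \<and> y \<in> carrier N})"

definition tensor_ker ::
  "('k, 'm) ring_scheme \<Rightarrow> ('k, 'a, 'p) module_scheme \<Rightarrow> ('k, 'b, 'q) module_scheme
    \<Rightarrow> ('a \<times> 'b \<Rightarrow> 'k) set"
  where "tensor_ker K M N =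
    \<Inter>{H. submodule H K (free_module K (carrier M \<times> carrier N)) \<and> tensor_rels K M N \<subseteq> H}"

definition tensor ::
  "('k, 'm) ring_scheme \<Rightarrow> ('k, 'a, 'p) module_scheme \<Rightarrow> ('k, 'b, 'q) module_scheme
    \<Rightarrow> ('k, ('a \<times> 'b \<Rightarrow> 'k) set) module"
  where "tensor K M N =
    quotient_module (free_module K (carrier M \<times> carrier N)) (tensor_ker K M N)"

definition pure_tensor ::
  "('k, 'm) ring_scheme \<Rightarrow> ('k, 'a, 'p) module_scheme \<Rightarrow> ('k, 'b, 'q) module_scheme
    \<Rightarrow> 'a \<Rightarrow> 'b \<Rightarrow> ('a \<times> 'b \<Rightarrow> 'k) set"
  where "pure_tensor K M N x y =
    tensor_ker K M N +>\<^bsub>free_module K (carrier M \<times> carrier N)\<^esub> free_gen K (x, y)"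

text \<open>For a bilinear \<open>B\<close> this is the linear map on the tensor product of \<open>M\<close> and \<open>N\<close> that
  sends each pure tensor of \<open>x\<close> and \<open>y\<close> to \<open>B x y\<close>; it evaluates \<open>B\<close> on an arbitrary
  representative of the coset \<open>t\<close>, and bilinearity makes the choice irrelevant.\<close>

definition tensor_lift ::
  "('k, 'm) ring_scheme \<Rightarrow> ('k, 'c, 'r) module_scheme \<Rightarrow> ('a \<Rightarrow> 'b \<Rightarrow> 'c)
    \<Rightarrow> ('a \<times> 'b \<Rightarrow> 'k) set \<Rightarrow> 'c"
  where "tensor_lift K P B t =
    (let f = (SOME f. f \<in> t) in
      \<Oplus>\<^bsub>P\<^esub>p\<in>{p. f p \<noteq> \<zero>\<^bsub>K\<^esub>}. f p \<odot>\<^bsub>P\<^esub> B (fst p) (snd p))"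

text \<open>\<open>tensor_map K P Q f g\<close> is the tensor product of the linear maps \<open>f\<close> and \<open>g\<close>, whose
  codomains are \<open>P\<close> and \<open>Q\<close>.\<close>

definition tensor_map ::
  "('k, 'm) ring_scheme \<Rightarrow> ('k, 'c, 'r) module_scheme \<Rightarrow> ('k, 'd, 's) module_scheme
    \<Rightarrow> ('a \<Rightarrow> 'c) \<Rightarrow> ('b \<Rightarrow> 'd) \<Rightarrow> ('a \<times> 'b \<Rightarrow> 'k) set \<Rightarrow> ('c \<times> 'd \<Rightarrow> 'k) set"
  where "tensor_map K P Q f g =
    tensor_lift K (tensor K P Q) (\<lambda>x y. pure_tensor K P Q (f x) (g y))"

definition tensor_flip ::
  "('k, 'm) ring_scheme \<Rightarrow> ('k, 'a, 'p) module_scheme \<Rightarrow> ('k, 'b, 'q) module_scheme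
    \<Rightarrow> ('a \<times> 'b \<Rightarrow> 'k) set \<Rightarrow> ('b \<times> 'a \<Rightarrow> 'k) set"
  where "tensor_flip K M N =
    tensor_lift K (tensor K N M) (\<lambda>x y. pure_tensor K N M y x)"

text \<open>The canonical isomorphism from \<open>tensor K (tensor K L M) N\<close> to
  \<open>tensor K L (tensor K M N)\<close>, and its inverse. Written tensor powers leave these implicit.\<close>

definition tensor_assoc ::
  "('k, 'm) ring_scheme \<Rightarrow> ('k, 'a, 'p) module_scheme \<Rightarrow> ('k, 'b, 'q) module_scheme
    \<Rightarrow> ('k, 'c, 'r) module_scheme
    \<Rightarrow> (('a \<times> 'b \<Rightarrow> 'k) set \<times> 'c \<Rightarrow> 'k) set \<Rightarrow> ('a \<times> ('b \<times> 'c \<Rightarrow> 'k) set \<Rightarrow> 'k) set"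
  where "tensor_assoc K L M N =
    (let T = tensor K L (tensor K M N) in
      tensor_lift K T (\<lambda>t z. tensor_lift K T (\<lambda>x y.
        pure_tensor K L (tensor K M N) x (pure_tensor K M N y z)) t))"

definition tensor_unassoc ::
  "('k, 'm) ring_scheme \<Rightarrow> ('k, 'a, 'p) module_scheme \<Rightarrow> ('k, 'b, 'q) module_scheme
    \<Rightarrow> ('k, 'c, 'r) module_scheme
    \<Rightarrow> ('a \<times> ('b \<times> 'c \<Rightarrow> 'k) set \<Rightarrow> 'k) set \<Rightarrow> (('a \<times> 'b \<Rightarrow> 'k) set \<times> 'c \<Rightarrow> 'k) set"
  where "tensor_unassoc K L M N =
    (let T = tensor K (tensor K L M) N in
      tensor_lift K T (\<lambda>x t. tensor_lift K T (\<lambda>y z.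
        pure_tensor K (tensor K L M) N (pure_tensor K L M x y) z) t))"

text \<open>The map \<open>1 \<otimes> \<tau> \<otimes> 1\<close> on the fourfold tensor power of \<open>X\<close>, with the bracketing
  \<open>(X \<otimes> X) \<otimes> (X \<otimes> X)\<close> on both sides.\<close>

definition tensor_middle_flip ::
  "('k, 'm) ring_scheme \<Rightarrow> ('k, 'a, 'p) module_scheme
    \<Rightarrow> (('a \<times> 'a \<Rightarrow> 'k) set \<times> ('a \<times> 'a \<Rightarrow> 'k) set \<Rightarrow> 'k) set
    \<Rightarrow> (('a \<times> 'a \<Rightarrow> 'k) set \<times> ('a \<times> 'a \<Rightarrow> 'k) set \<Rightarrow> 'k) set"
  where "tensor_middle_flip K X =
    (let XX = tensor K X X in
      tensor_unassoc K X X XX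
      \<circ> tensor_map K X (tensor K X XX) id
          (tensor_assoc K X X X \<circ> tensor_map K XX X (tensor_flip K X X) id
           \<circ> tensor_unassoc K X X X)
      \<circ> tensor_assoc K X X XX)"


section \<open>Coalgebras\<close>

text \<open>The counit axioms say that \<open>(\<epsilon> \<otimes> 1) \<Delta>\<close> and \<open>(1 \<otimes> \<epsilon>) \<Delta>\<close> are the canonical
  isomorphisms \<open>x \<mapsto> 1 \<otimes> x\<close> and \<open>x \<mapsto> x \<otimes> 1\<close>.\<close>

locale counital_coalgebra = field K + module K X
  for K (structure) and X (structure) +
  fixes \<Delta> and \<epsilon>
  assumes comult_linear: "\<Delta> \<in> linear_hom K X (tensor K X X)"
    and counit_linear: "\<epsilon> \<in> linear_hom K X (self_module K)"
    and coassociative: "x \<in> carrier X \<Longrightarrow>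
      tensor_assoc K X X X (tensor_map K (tensor K X X) X \<Delta> id (\<Delta> x))
        = tensor_map K X (tensor K X X) id \<Delta> (\<Delta> x)"
    and counit_left: "x \<in> carrier X \<Longrightarrow>
      tensor_map K (self_module K) X \<epsilon> id (\<Delta> x) = pure_tensor K (self_module K) X \<one>\<^bsub>K\<^esub> x"
    and counit_right: "x \<in> carrier X \<Longrightarrow>
      tensor_map K X (self_module K) id \<epsilon> (\<Delta> x) = pure_tensor K X (self_module K) x \<one>\<^bsub>K\<^esub>"

locale cocommutative_coalgebra = counital_coalgebra K X \<Delta> \<epsilon>
  for K (structure) and X (structure) and \<Delta> and \<epsilon> +
  assumes cocommutative: "x \<in> carrier X \<Longrightarrow> tensor_flip K X X (\<Delta> x) = \<Delta> x"


section \<open>Self-distributive maps and the Yang--Baxter equation\<close>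

text \<open>Threefold tensor powers are bracketed to the left, and maps are compared on carriers only.\<close>

definition self_distributive ::
  "('k, 'm) ring_scheme \<Rightarrow> ('k, 'a, 'p) module_scheme \<Rightarrow> ('a \<Rightarrow> ('a \<times> 'a \<Rightarrow> 'k) set)
    \<Rightarrow> (('a \<times> 'a \<Rightarrow> 'k) set \<Rightarrow> 'a) \<Rightarrow> bool"
  where "self_distributive K X \<Delta> q \<longleftrightarrow>
    (let XX = tensor K X X in
      \<forall>t\<in>carrier (tensor K XX X).
        (q \<circ> tensor_map K X X q id) t
        = (q \<circ> tensor_map K X X q q \<circ> tensor_middle_flip K X \<circ> tensor_map K XX XX id \<Delta>) t)"

definition comult_compatible ::
  "('k, 'm) ring_scheme \<Rightarrow> ('k, 'a, 'p) module_scheme \<Rightarrow> ('a \<Rightarrow> ('a \<times> 'a \<Rightarrow> 'k) set)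
    \<Rightarrow> (('a \<times> 'a \<Rightarrow> 'k) set \<Rightarrow> 'a) \<Rightarrow> bool"
  where "comult_compatible K X \<Delta> q \<longleftrightarrow>
    (let XX = tensor K X X in
      \<forall>t\<in>carrier XX.
        (\<Delta> \<circ> q) t
        = (tensor_map K X X q q \<circ> tensor_middle_flip K X \<circ> tensor_map K XX XX \<Delta> \<Delta>) t)"

definition induced_R ::
  "('k, 'm) ring_scheme \<Rightarrow> ('k, 'a, 'p) module_scheme \<Rightarrow> ('a \<Rightarrow> ('a \<times> 'a \<Rightarrow> 'k) set)
    \<Rightarrow> (('a \<times> 'a \<Rightarrow> 'k) set \<Rightarrow> 'a) \<Rightarrow> ('a \<times> 'a \<Rightarrow> 'k) set \<Rightarrow> ('a \<times> 'a \<Rightarrow> 'k) set"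
  where "induced_R K X \<Delta> q =
    (let XX = tensor K X X in
      tensor_map K X X id q
      \<circ> tensor_assoc K X X X
      \<circ> tensor_map K XX X (tensor_flip K X X) id
      \<circ> tensor_unassoc K X X X
      \<circ> tensor_map K X XX id \<Delta>)"

definition yang_baxter ::
  "('k, 'm) ring_scheme \<Rightarrow> ('k, 'a, 'p) module_scheme
    \<Rightarrow> (('a \<times> 'a \<Rightarrow> 'k) set \<Rightarrow> ('a \<times> 'a \<Rightarrow> 'k) set) \<Rightarrow> bool"
  where "yang_baxter K X R \<longleftrightarrow>
    (let XX = tensor K X X;
         R12 = tensor_map K XX X R id;
         R23 = tensor_unassoc K X X X \<circ> tensor_map K X XX id R \<circ> tensor_assoc K X X X in
      \<forall>t\<in>carrier (tensor K XX X). (R12 \<circ> R23 \<circ> R12) t = (R23 \<circ> R12 \<circ> R23) t)"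

end

theory Submission
  imports Defs
begin

text \<open>
Write \<open>x \<triangleleft> y\<close> for \<open>q (x \<otimes> y)\<close> and use Sweedler notation for coproducts. Then
\<open>R (x \<otimes> y) = y\<^sub>1 \<otimes> (x \<triangleleft> y\<^sub>2)\<close>, and on \<open>x \<otimes> y \<otimes> z\<close> the two sides of the Yang--Baxter equation are

  \<open>z\<^sub>1 \<otimes> (y\<^sub>1 \<triangleleft> z\<^sub>2) \<otimes> ((x \<triangleleft> y\<^sub>2) \<triangleleft> z\<^sub>3)\<close>  and  \<open>z\<^sub>1 \<otimes> (y \<triangleleft> z\<^sub>3)\<^sub>1 \<otimes> ((x \<triangleleft> z\<^sub>2) \<triangleleft> (y \<triangleleft> z\<^sub>3)\<^sub>2)\<close>.

Self-distributivity rewrites the first as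
\<open>z\<^sub>1 \<otimes> (y\<^sub>1 \<triangleleft> z\<^sub>2) \<otimes> ((x \<triangleleft> z\<^sub>3) \<triangleleft> (y\<^sub>2 \<triangleleft> z\<^sub>4))\<close>, and compatibility with the comultiplication rewrites the
second as \<open>z\<^sub>1 \<otimes> (y\<^sub>1 \<triangleleft> z\<^sub>3) \<otimes> ((x \<triangleleft> z\<^sub>2) \<triangleleft> (y\<^sub>2 \<triangleleft> z\<^sub>4))\<close> (lemmas \<open>R12_R23_R12_pure\<close> and
\<open>R23_R12_R23_pure\<close>). They differ by the exchange of \<open>z\<^sub>2\<close> and \<open>z\<^sub>3\<close>, which is harmless because
\<open>X\<close> is coassociative and cocommutative (lemma \<open>sweedler_swap_middle\<close>).

Sweedler notation is made precise without choosing representatives: the sum of \<open>B x\<^sub>1 x\<^sub>2\<close> is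
\<open>tensor_lift K P B (\<Delta> x)\<close> for a bilinear map \<open>B\<close> into \<open>P\<close>. Its rules of calculation all come from the
universal property of the tensor product: \<open>tensor_lift_linear\<close> and \<open>tensor_lift_pure\<close> (a bilinear
map extends to a linear one), \<open>linear_eq_on_tensor\<close> (linear maps that agree on pure tensors are
equal), and their consequence \<open>tensor_lift_commute\<close> (two such sums may be exchanged). The
universal property is proved from the construction of the tensor product as a quotient of a free
module.
\<close>

section \<open>Linear maps\<close>

lemma linear_homI:
  assumes "\<And>x. x \<in> carrier M \<Longrightarrow> f x \<in> carrier N"
    and "\<And>x y. x \<in> carrier M \<Longrightarrow> y \<in> carrier M \<Longrightarrow> f (x \<oplus>\<^bsub>M\<^esub> y) = f x \<oplus>\<^bsub>N\<^esub> f y"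
    and "\<And>a x. a \<in> carrier K \<Longrightarrow> x \<in> carrier M \<Longrightarrow> f (a \<odot>\<^bsub>M\<^esub> x) = a \<odot>\<^bsub>N\<^esub> f x"
  shows "f \<in> linear_hom K M N"
  using assms by (auto simp: linear_hom_def hom_def)

lemma linear_hom_closed: "f \<in> linear_hom K M N \<Longrightarrow> x \<in> carrier M \<Longrightarrow> f x \<in> carrier N"
  by (auto simp: linear_hom_def hom_def)

lemma linear_hom_add:
  "f \<in> linear_hom K M N \<Longrightarrow> x \<in> carrier M \<Longrightarrow> y \<in> carrier M \<Longrightarrow> f (x \<oplus>\<^bsub>M\<^esub> y) = f x \<oplus>\<^bsub>N\<^esub> f y"
  by (auto simp: linear_hom_def hom_def)

lemma linear_hom_smult:
  "f \<in> linear_hom K M N \<Longrightarrow> a \<in> carrier K \<Longrightarrow> x \<in> carrier M \<Longrightarrow> f (a \<odot>\<^bsub>M\<^esub> x) = a \<odot>\<^bsub>N\<^esub> f x"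
  by (auto simp: linear_hom_def)

lemma linear_hom_zero:
  assumes "module K M" "module K N" "f \<in> linear_hom K M N"
  shows "f \<zero>\<^bsub>M\<^esub> = \<zero>\<^bsub>N\<^esub>"
proof -
  interpret M: module K M by fact
  interpret N: module K N by fact
  have "f (\<zero>\<^bsub>K\<^esub> \<odot>\<^bsub>M\<^esub> \<zero>\<^bsub>M\<^esub>) = \<zero>\<^bsub>K\<^esub> \<odot>\<^bsub>N\<^esub> f \<zero>\<^bsub>M\<^esub>"
    using assms(3) by (rule linear_hom_smult) auto
  then show ?thesis
    using linear_hom_closed[OF assms(3)] by simp
qed

lemma linear_hom_minus:
  assumes "module K M" "module K N" "f \<in> linear_hom K M N" "x \<in> carrier M" "y \<in> carrier M"
  shows "f (x \<ominus>\<^bsub>M\<^esub> y) = f x \<ominus>\<^bsub>N\<^esub> f y"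
proof -
  interpret M: module K M by fact
  interpret N: module K N by fact
  have f: "f u \<in> carrier N" if "u \<in> carrier M" for u
    using linear_hom_closed[OF assms(3) that] .
  have "f (x \<ominus>\<^bsub>M\<^esub> y) \<oplus>\<^bsub>N\<^esub> f y = f (x \<ominus>\<^bsub>M\<^esub> y \<oplus>\<^bsub>M\<^esub> y)"
    using assms linear_hom_add[OF assms(3)] by simp
  also have "\<dots> = f x"
    using assms(4,5) by (simp add: M.minus_eq M.a_assoc M.l_neg)
  finally have "f x \<ominus>\<^bsub>N\<^esub> f y = f (x \<ominus>\<^bsub>M\<^esub> y) \<oplus>\<^bsub>N\<^esub> f y \<ominus>\<^bsub>N\<^esub> f y" by simp
  also have "\<dots> = f (x \<ominus>\<^bsub>M\<^esub> y)"
    using f assms(4,5) by (simp add: N.minus_eq N.a_assoc N.r_neg)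
  finally show ?thesis by simp
qed

lemma linear_hom_ident: "(\<lambda>x. x) \<in> linear_hom K M M"
  by (rule linear_homI) auto

lemma linear_hom_id: "id \<in> linear_hom K M M"
  by (rule linear_homI) auto

lemma linear_hom_compose:
  assumes "f \<in> linear_hom K M N" "g \<in> linear_hom K N P"
  shows "(\<lambda>x. g (f x)) \<in> linear_hom K M P"
  using assms
  by (intro linear_homI) (simp_all add: linear_hom_closed linear_hom_add linear_hom_smult)

lemma linear_hom_sum:
  assumes N: "module K N" and f: "f \<in> linear_hom K M N" and g: "g \<in> linear_hom K M N"
  shows "(\<lambda>x. f x \<oplus>\<^bsub>N\<^esub> g x) \<in> linear_hom K M N"
proof -
  interpret N: module K N by fact
  show ?thesis
    using linear_hom_closed[OF f] linear_hom_closed[OF g]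
    by (intro linear_homI)
       (simp_all add: linear_hom_add[OF f] linear_hom_add[OF g] linear_hom_smult[OF f]
          linear_hom_smult[OF g] N.a_ac N.smult_r_distr)
qed

lemma linear_hom_scaled:
  assumes N: "module K N" and f: "f \<in> linear_hom K M N" and a: "a \<in> carrier K"
  shows "(\<lambda>x. a \<odot>\<^bsub>N\<^esub> f x) \<in> linear_hom K M N"
proof -
  interpret N: module K N by fact
  show ?thesis
    using linear_hom_closed[OF f] a
    by (intro linear_homI)
       (simp_all add: linear_hom_add[OF f] linear_hom_smult[OF f] N.smult_r_distr
          N.smult_assoc1[symmetric] N.m_comm)
qed

text \<open>This turns "linear maps agree on generators" into "a submodule contains the generators", the form
in which both the free module and the kernel of the tensor product can be handled.\<close>

lemma equalizer_submodule:
  assumes M: "module K M" and N: "module K N"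
    and f: "f \<in> linear_hom K M N" and g: "g \<in> linear_hom K M N"
  shows "submodule {x \<in> carrier M. f x = g x} K M"
proof -
  interpret M: module K M by fact
  have neg: "\<ominus>\<^bsub>M\<^esub> x = (\<ominus>\<^bsub>K\<^esub> \<one>\<^bsub>K\<^esub>) \<odot>\<^bsub>M\<^esub> x" if "x \<in> carrier M" for x
    using that by (simp add: M.smult_l_minus)
  show ?thesis
    by (rule M.submoduleI)
       (auto simp: linear_hom_zero[OF M N f] linear_hom_zero[OF M N g] linear_hom_add[OF f]
          linear_hom_add[OF g] linear_hom_smult[OF f] linear_hom_smult[OF g] neg)
qed

section \<open>Free modules\<close>

lemma free_module_simps:
  "carrier (free_module K I) = {f. (\<forall>i\<in>I. f i \<in> carrier K) \<and> (\<forall>i. i \<notin> I \<longrightarrow> f i = \<zero>\<^bsub>K\<^esub>)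
                  \<and> finite {i. f i \<noteq> \<zero>\<^bsub>K\<^esub>}}"
  "zero (free_module K I) = (\<lambda>i. \<zero>\<^bsub>K\<^esub>)"
  "add (free_module K I) = (\<lambda>f g i. f i \<oplus>\<^bsub>K\<^esub> g i)"
  "smult (free_module K I) = (\<lambda>a f i. a \<otimes>\<^bsub>K\<^esub> f i)"
  by (simp_all add: free_module_def)

lemma free_module_coeff_closed:
  assumes "cring K" "f \<in> carrier (free_module K I)"
  shows "f i \<in> carrier K"
proof -
  interpret cring K by fact
  show ?thesis using assms(2) by (cases "i \<in> I") (auto simp: free_module_simps)
qed

lemma free_module_add_closed:
  assumes "cring K" "f \<in> carrier (free_module K I)" "g \<in> carrier (free_module K I)"
  shows "(\<lambda>i. f i \<oplus>\<^bsub>K\<^esub> g i) \<in> carrier (free_module K I)"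
proof -
  interpret cring K by fact
  have "finite ({i. f i \<noteq> \<zero>\<^bsub>K\<^esub>} \<union> {i. g i \<noteq> \<zero>\<^bsub>K\<^esub>})"
    using assms by (auto simp: free_module_simps)
  then have "finite {i. f i \<oplus>\<^bsub>K\<^esub> g i \<noteq> \<zero>\<^bsub>K\<^esub>}"
    by (rule rev_finite_subset) auto
  then show ?thesis using assms by (auto simp: free_module_simps)
qed

lemma free_module_smult_closed:
  assumes "cring K" "a \<in> carrier K" "f \<in> carrier (free_module K I)"
  shows "(\<lambda>i. a \<otimes>\<^bsub>K\<^esub> f i) \<in> carrier (free_module K I)"
proof -
  interpret cring K by fact
  have "finite {i. f i \<noteq> \<zero>\<^bsub>K\<^esub>}"
    using assms by (auto simp: free_module_simps)
  then have "finite {i. a \<otimes>\<^bsub>K\<^esub> f i \<noteq> \<zero>\<^bsub>K\<^esub>}"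
    using assms(2) by (elim rev_finite_subset) auto
  then show ?thesis using assms by (auto simp: free_module_simps)
qed

lemma module_free_module:
  assumes "cring K"
  shows "module K (free_module K I)"
proof -
  interpret cring K by fact
  note coeff = free_module_coeff_closed[OF assms, where I=I]
  note add = free_module_add_closed[OF assms, where I=I]
  note sm = free_module_smult_closed[OF assms, where I=I]
  have ops: "zero (free_module K I) = (\<lambda>i. \<zero>\<^bsub>K\<^esub>)"
    "add (free_module K I) = (\<lambda>f g i. f i \<oplus>\<^bsub>K\<^esub> g i)"
    "smult (free_module K I) = (\<lambda>a f i. a \<otimes>\<^bsub>K\<^esub> f i)"
    by (simp_all add: free_module_simps)
  have grp: "abelian_group (free_module K I)"
  proof (rule abelian_groupI; unfold ops)
    show "(\<lambda>i. \<zero>\<^bsub>K\<^esub>) \<in> carrier (free_module K I)" by (simp add: free_module_simps)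
    fix f assume f: "f \<in> carrier (free_module K I)"
    show "(\<lambda>i. \<zero>\<^bsub>K\<^esub> \<oplus>\<^bsub>K\<^esub> f i) = f" using coeff[OF f] by simp
    have "(\<lambda>i. \<ominus>\<^bsub>K\<^esub> \<one>\<^bsub>K\<^esub> \<otimes>\<^bsub>K\<^esub> f i) \<in> carrier (free_module K I)"
      by (rule sm) (auto simp: f)
    moreover have "(\<lambda>i. \<ominus>\<^bsub>K\<^esub> \<one>\<^bsub>K\<^esub> \<otimes>\<^bsub>K\<^esub> f i \<oplus>\<^bsub>K\<^esub> f i) = (\<lambda>i. \<zero>\<^bsub>K\<^esub>)"
      using coeff[OF f] by (simp add: l_minus l_neg)
    ultimately show "\<exists>y\<in>carrier (free_module K I). (\<lambda>i. y i \<oplus>\<^bsub>K\<^esub> f i) = (\<lambda>i. \<zero>\<^bsub>K\<^esub>)"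
      by (intro bexI)
  qed (auto simp: add coeff a_ac)
  show ?thesis
    by (rule moduleI; (unfold ops)?)
       (auto simp: grp sm coeff assms l_distr r_distr m_assoc)
qed

lemma free_gen_closed:
  assumes "cring K" "i \<in> I"
  shows "free_gen K i \<in> carrier (free_module K I)"
proof -
  interpret cring K by fact
  have "finite {j. free_gen K i j \<noteq> \<zero>\<^bsub>K\<^esub>}"
    by (rule finite_subset[of _ "{i}"]) (auto simp: free_gen_def)
  then show ?thesis using assms by (auto simp: free_module_simps free_gen_def)
qed

text \<open>Induction on the size of the support: erasing one coefficient \<open>f i\<close> leaves a function with
smaller support, and adding back \<open>f i\<close> times the generator at \<open>i\<close> recovers \<open>f\<close>.\<close>

lemma free_module_spanned_by_gens:
  assumes K: "cring K" and H: "submodule H K (free_module K I)"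
    and gen: "\<And>i. i \<in> I \<Longrightarrow> free_gen K i \<in> H"
    and f: "f \<in> carrier (free_module K I)"
  shows "f \<in> H"
proof -
  interpret cring K by fact
  interpret F: module K "free_module K I" by (rule module_free_module) fact
  note H' = F.submoduleE[OF H]
  have zero: "\<zero>\<^bsub>free_module K I\<^esub> \<in> H"
    using subgroup.one_closed[OF submodule.axioms(1)[OF H]] by simp
  have "finite {i. f i \<noteq> \<zero>\<^bsub>K\<^esub>}" using f by (simp add: free_module_simps)
  then show ?thesis
    using f
  proof (induction "{i. f i \<noteq> \<zero>\<^bsub>K\<^esub>}" arbitrary: f rule: finite_induct)
    case empty
    then have "f = \<zero>\<^bsub>free_module K I\<^esub>" by (auto simp: free_module_simps)
    with zero show ?case by simp
  next
    case (insert i S)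
    let ?g = "f(i := \<zero>\<^bsub>K\<^esub>)"
    have i: "i \<in> I" using insert.hyps(4) insert.prems by (auto simp: free_module_simps)
    have supp: "S = {j. ?g j \<noteq> \<zero>\<^bsub>K\<^esub>}" using insert.hyps(2,4) by auto
    have "?g \<in> carrier (free_module K I)"
      using insert.prems insert.hyps(1) supp by (auto simp: free_module_simps)
    then have "?g \<in> H" by (rule insert.hyps(3)[OF supp])
    moreover have "f i \<odot>\<^bsub>free_module K I\<^esub> free_gen K i \<in> H"
      by (intro H'(4) gen i free_module_coeff_closed[OF K insert.prems])
    ultimately have "?g \<oplus>\<^bsub>free_module K I\<^esub> f i \<odot>\<^bsub>free_module K I\<^esub> free_gen K i \<in> H"
      by (rule H'(5))
    also have "?g \<oplus>\<^bsub>free_module K I\<^esub> f i \<odot>\<^bsub>free_module K I\<^esub> free_gen K i = f"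
      using free_module_coeff_closed[OF K insert.prems]
      by (auto simp: free_module_simps free_gen_def)
    finally show ?case .
  qed
qed

text \<open>The linear extension of a family \<open>b\<close> from the generators. The sum runs over the support of \<open>f\<close>,
so that \<^const>\<open>tensor_lift\<close> is literally this sum on a chosen representative.\<close>

definition free_lift ::
  "('k, 'm) ring_scheme \<Rightarrow> ('k, 'c, 'r) module_scheme \<Rightarrow> ('i \<Rightarrow> 'c) \<Rightarrow> ('i \<Rightarrow> 'k) \<Rightarrow> 'c"
  where "free_lift K P b f = (\<Oplus>\<^bsub>P\<^esub>i\<in>{i. f i \<noteq> \<zero>\<^bsub>K\<^esub>}. f i \<odot>\<^bsub>P\<^esub> b i)"

text \<open>The support varies with \<open>f\<close>, which is awkward for additivity; enlarging it by zero terms lets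
two functions be summed over one common index set.\<close>

lemma free_lift_eq_sum_superset:
  assumes P: "module K P" and b: "\<And>i. i \<in> I \<Longrightarrow> b i \<in> carrier P"
    and f: "f \<in> carrier (free_module K I)"
    and A: "finite A" "A \<subseteq> I" "{i. f i \<noteq> \<zero>\<^bsub>K\<^esub>} \<subseteq> A"
  shows "free_lift K P b f = (\<Oplus>\<^bsub>P\<^esub>i\<in>A. f i \<odot>\<^bsub>P\<^esub> b i)"
proof -
  interpret P: module K P by fact
  have K: "cring K" ..
  show ?thesis
    unfolding free_lift_def
    by (rule P.M.add.finprod_mono_neutral_cong_left)
       (use A b free_module_coeff_closed[OF K f] in \<open>auto simp: subset_iff\<close>)
qed

lemma free_lift_linear:
  assumes P: "module K P" and b: "\<And>i. i \<in> I \<Longrightarrow> b i \<in> carrier P"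
  shows "free_lift K P b \<in> linear_hom K (free_module K I) P"
proof -
  interpret P: module K P by fact
  have K: "cring K" ..
  let ?F = "free_module K I"
  let ?S = "\<lambda>f. {i. f i \<noteq> \<zero>\<^bsub>K\<^esub>}"
  note coeff = free_module_coeff_closed[OF K, where I=I]
  note sup = free_lift_eq_sum_superset[OF P b]
  have S: "finite (?S f)" "?S f \<subseteq> I" if "f \<in> carrier ?F" for f
    using that by (auto simp: free_module_simps)
  show ?thesis
  proof (rule linear_homI)
    fix f assume f: "f \<in> carrier ?F"
    show "free_lift K P b f \<in> carrier P"
      unfolding free_lift_def using S(2)[OF f] b coeff[OF f] by (intro P.finsum_closed) auto
    fix g assume g: "g \<in> carrier ?F"
    let ?A = "?S f \<union> ?S g"
    have A: "finite ?A" "?A \<subseteq> I" using S[OF f] S[OF g] by auto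
    have "free_lift K P b (f \<oplus>\<^bsub>?F\<^esub> g) = (\<Oplus>\<^bsub>P\<^esub>i\<in>?A. (f i \<oplus>\<^bsub>K\<^esub> g i) \<odot>\<^bsub>P\<^esub> b i)"
      using free_module_add_closed[OF K f g] A
      by (subst sup[where A = ?A]) (auto simp: free_module_simps(3))
    also have "\<dots> = (\<Oplus>\<^bsub>P\<^esub>i\<in>?A. f i \<odot>\<^bsub>P\<^esub> b i \<oplus>\<^bsub>P\<^esub> g i \<odot>\<^bsub>P\<^esub> b i)"
      using A(2) coeff[OF f] coeff[OF g] b
      by (intro P.finsum_cong') (auto intro!: P.smult_l_distr)
    also have "\<dots> = (\<Oplus>\<^bsub>P\<^esub>i\<in>?A. f i \<odot>\<^bsub>P\<^esub> b i) \<oplus>\<^bsub>P\<^esub> (\<Oplus>\<^bsub>P\<^esub>i\<in>?A. g i \<odot>\<^bsub>P\<^esub> b i)"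
      using A(2) coeff[OF f] coeff[OF g] b by (intro P.finsum_addf) auto
    also have "\<dots> = free_lift K P b f \<oplus>\<^bsub>P\<^esub> free_lift K P b g"
      by (simp only: sup[OF _ f A] sup[OF _ g A] Un_upper1 Un_upper2)
    finally show "free_lift K P b (f \<oplus>\<^bsub>?F\<^esub> g) = free_lift K P b f \<oplus>\<^bsub>P\<^esub> free_lift K P b g" .
  next
    fix a f assume a: "a \<in> carrier K" and f: "f \<in> carrier ?F"
    have "free_lift K P b (a \<odot>\<^bsub>?F\<^esub> f) = (\<Oplus>\<^bsub>P\<^esub>i\<in>?S f. (a \<otimes>\<^bsub>K\<^esub> f i) \<odot>\<^bsub>P\<^esub> b i)"
      using free_module_smult_closed[OF K a f] S[OF f] a
      by (subst sup[where A = "?S f"]) (auto simp: free_module_simps(4))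
    also have "\<dots> = (\<Oplus>\<^bsub>P\<^esub>i\<in>?S f. a \<odot>\<^bsub>P\<^esub> (f i \<odot>\<^bsub>P\<^esub> b i))"
      using S(2)[OF f] coeff[OF f] b a
      by (intro P.finsum_cong') (auto intro!: P.smult_assoc1)
    also have "\<dots> = a \<odot>\<^bsub>P\<^esub> (\<Oplus>\<^bsub>P\<^esub>i\<in>?S f. f i \<odot>\<^bsub>P\<^esub> b i)"
      using S[OF f] coeff[OF f] b a by (intro P.finsum_smult_ldistr[symmetric]) auto
    finally show "free_lift K P b (a \<odot>\<^bsub>?F\<^esub> f) = a \<odot>\<^bsub>P\<^esub> free_lift K P b f"
      by (simp add: free_lift_def)
  qed
qed

lemma free_lift_gen:
  assumes P: "module K P" and b: "\<And>i. i \<in> I \<Longrightarrow> b i \<in> carrier P" and i: "i \<in> I"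
  shows "free_lift K P b (free_gen K i) = b i"
proof -
  interpret P: module K P by fact
  have K: "cring K" ..
  have "free_lift K P b (free_gen K i) = (\<Oplus>\<^bsub>P\<^esub>j\<in>{i}. free_gen K i j \<odot>\<^bsub>P\<^esub> b j)"
    by (rule free_lift_eq_sum_superset[OF P b free_gen_closed[OF K i]])
       (use i in \<open>auto simp: free_gen_def\<close>)
  also have "\<dots> = b i" using b[OF i] by (simp add: free_gen_def)
  finally show ?thesis .
qed

section \<open>Quotient modules\<close>

lemma quotient_module_simps:
  "carrier (quotient_module M H) = a_rcosets\<^bsub>M\<^esub> H"
  "zero (quotient_module M H) = H"
  "add (quotient_module M H) = set_add M"
  "smult (quotient_module M H) = (\<lambda>a S. \<Union>s\<in>S. H +>\<^bsub>M\<^esub> (a \<odot>\<^bsub>M\<^esub> s))"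
  by (simp_all add: quotient_module_def)

lemma submodule_imp_abelian_subgroup:
  assumes M: "module K M" and H: "submodule H K M"
  shows "abelian_subgroup H M"
proof -
  interpret M: module K M by fact
  show ?thesis
    using H by (intro abelian_subgroupI3 additive_subgroupI M.abelian_group_axioms)
      (rule submodule.axioms)
qed

lemma coset_eq_iff:
  assumes M: "module K M" and H: "submodule H K M" and "x \<in> carrier M" "y \<in> carrier M"
  shows "H +>\<^bsub>M\<^esub> x = H +>\<^bsub>M\<^esub> y \<longleftrightarrow> x \<ominus>\<^bsub>M\<^esub> y \<in> H"
proof -
  interpret M: module K M by fact
  interpret H: abelian_subgroup H M using M H by (rule submodule_imp_abelian_subgroup)
  show ?thesis
    using H.a_rcos_module[OF assms(4,3)] H.a_rcos_self[OF assms(3)]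
      H.a_repr_independence'[OF _ assms(4), of x]
    by (auto simp: M.minus_eq)
qed

lemma quotient_module_carrier:
  "carrier (quotient_module M H) = (\<lambda>x. H +>\<^bsub>M\<^esub> x) ` carrier M"
  unfolding quotient_module_simps A_RCOSETS_def' by auto

lemma coset_map_linear:
  assumes M: "module K M" and H: "submodule H K M"
  shows "(\<lambda>x. H +>\<^bsub>M\<^esub> x) \<in> linear_hom K M (quotient_module M H)"
proof -
  interpret M: module K M by fact
  interpret H: abelian_subgroup H M using M H by (rule submodule_imp_abelian_subgroup)
  show ?thesis
  proof (rule linear_homI)
    fix a x assume a: "a \<in> carrier K" and x: "x \<in> carrier M"
    have same: "H +>\<^bsub>M\<^esub> (a \<odot>\<^bsub>M\<^esub> s) = H +>\<^bsub>M\<^esub> (a \<odot>\<^bsub>M\<^esub> x)" if s: "s \<in> H +>\<^bsub>M\<^esub> x" for s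
    proof -
      have sM: "s \<in> carrier M" using s x H.a_elemrcos_carrier by blast
      have "s \<ominus>\<^bsub>M\<^esub> x \<in> H"
        using H.a_rcos_module[OF x sM] s by (simp add: M.minus_eq)
      then have "a \<odot>\<^bsub>M\<^esub> (s \<ominus>\<^bsub>M\<^esub> x) \<in> H"
        using a submodule.smult_closed[OF H] by blast
      then have "a \<odot>\<^bsub>M\<^esub> s \<ominus>\<^bsub>M\<^esub> a \<odot>\<^bsub>M\<^esub> x \<in> H"
        using a x sM by (simp add: M.minus_eq M.smult_r_distr M.smult_r_minus)
      then show ?thesis using a x sM by (simp add: coset_eq_iff[OF M H])
    qed
    have "a \<odot>\<^bsub>quotient_module M H\<^esub> (H +>\<^bsub>M\<^esub> x)
        = (\<Union>s\<in>H +>\<^bsub>M\<^esub> x. H +>\<^bsub>M\<^esub> (a \<odot>\<^bsub>M\<^esub> x))"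
      unfolding quotient_module_simps by (rule SUP_cong[OF refl same])
    also have "\<dots> = H +>\<^bsub>M\<^esub> (a \<odot>\<^bsub>M\<^esub> x)"
      using H.a_rcos_self[OF x] by blast
    finally show "H +>\<^bsub>M\<^esub> (a \<odot>\<^bsub>M\<^esub> x) = a \<odot>\<^bsub>quotient_module M H\<^esub> (H +>\<^bsub>M\<^esub> x)"
      by (rule sym)
  next
    fix x assume x: "x \<in> carrier M"
    then show "H +>\<^bsub>M\<^esub> x \<in> carrier (quotient_module M H)"
      by (simp add: quotient_module_carrier)
    fix y assume "y \<in> carrier M"
    with x show "H +>\<^bsub>M\<^esub> (x \<oplus>\<^bsub>M\<^esub> y)
        = (H +>\<^bsub>M\<^esub> x) \<oplus>\<^bsub>quotient_module M H\<^esub> (H +>\<^bsub>M\<^esub> y)"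
      by (simp only: quotient_module_simps(3) H.a_rcos_sum)
  qed
qed

text \<open>Every element of \<open>Q\<close> has a preimage, so each module law of \<open>Q\<close> is the image of the same law
of \<open>M\<close>. This gives the quotient its module structure without computing with cosets.\<close>

lemma module_epi_image:
  assumes M: "module K M" and p: "p \<in> linear_hom K M Q"
    and onto: "carrier Q = p ` carrier M" and zero: "\<zero>\<^bsub>Q\<^esub> = p \<zero>\<^bsub>M\<^esub>"
  shows "module K Q"
proof -
  interpret M: module K M by fact
  note add = linear_hom_add[OF p, symmetric] and sm = linear_hom_smult[OF p, symmetric]
  have cl: "p x \<in> carrier Q" if "x \<in> carrier M" for x
    using linear_hom_closed[OF p that] .
  have grp: "abelian_group Q"
  proof (rule abelian_groupI)
    show "\<zero>\<^bsub>Q\<^esub> \<in> carrier Q" by (simp add: zero cl)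
    fix u assume "u \<in> carrier Q"
    then obtain x where x: "x \<in> carrier M" "u = p x" using onto by blast
    show "\<zero>\<^bsub>Q\<^esub> \<oplus>\<^bsub>Q\<^esub> u = u" using x by (simp add: zero add)
    have "p (\<ominus>\<^bsub>M\<^esub> x) \<oplus>\<^bsub>Q\<^esub> u = \<zero>\<^bsub>Q\<^esub>" using x by (simp add: zero add M.l_neg)
    then show "\<exists>v\<in>carrier Q. v \<oplus>\<^bsub>Q\<^esub> u = \<zero>\<^bsub>Q\<^esub>" using cl x by blast
    fix v assume "v \<in> carrier Q"
    then obtain y where y: "y \<in> carrier M" "v = p y" using onto by blast
    show "u \<oplus>\<^bsub>Q\<^esub> v \<in> carrier Q" using x y by (simp add: add cl)
    show "u \<oplus>\<^bsub>Q\<^esub> v = v \<oplus>\<^bsub>Q\<^esub> u" using x y by (simp add: add M.a_comm)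
    fix w assume "w \<in> carrier Q"
    then obtain z where z: "z \<in> carrier M" "w = p z" using onto by blast
    show "u \<oplus>\<^bsub>Q\<^esub> v \<oplus>\<^bsub>Q\<^esub> w = u \<oplus>\<^bsub>Q\<^esub> (v \<oplus>\<^bsub>Q\<^esub> w)"
      using x y z by (simp add: add M.a_assoc)
  qed
  show ?thesis
  proof (rule moduleI[OF M.is_cring grp])
    fix a u assume a: "a \<in> carrier K" and "u \<in> carrier Q"
    then obtain x where x: "x \<in> carrier M" "u = p x" using onto by blast
    show "a \<odot>\<^bsub>Q\<^esub> u \<in> carrier Q" using a x by (simp add: sm cl)
    fix b assume b: "b \<in> carrier K"
    show "(a \<oplus>\<^bsub>K\<^esub> b) \<odot>\<^bsub>Q\<^esub> u = a \<odot>\<^bsub>Q\<^esub> u \<oplus>\<^bsub>Q\<^esub> b \<odot>\<^bsub>Q\<^esub> u"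
      using a b x by (simp add: sm add M.smult_l_distr)
    show "(a \<otimes>\<^bsub>K\<^esub> b) \<odot>\<^bsub>Q\<^esub> u = a \<odot>\<^bsub>Q\<^esub> (b \<odot>\<^bsub>Q\<^esub> u)"
      using a b x by (simp add: sm M.smult_assoc1)
  next
    fix a u v assume a: "a \<in> carrier K" and "u \<in> carrier Q" "v \<in> carrier Q"
    then obtain x y where x: "x \<in> carrier M" "u = p x" and y: "y \<in> carrier M" "v = p y"
      using onto by blast
    show "a \<odot>\<^bsub>Q\<^esub> (u \<oplus>\<^bsub>Q\<^esub> v) = a \<odot>\<^bsub>Q\<^esub> u \<oplus>\<^bsub>Q\<^esub> a \<odot>\<^bsub>Q\<^esub> v"
      using a x y by (simp add: sm add M.smult_r_distr)
  next
    fix u assume "u \<in> carrier Q"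
    then obtain x where x: "x \<in> carrier M" "u = p x" using onto by blast
    show "\<one>\<^bsub>K\<^esub> \<odot>\<^bsub>Q\<^esub> u = u" using x by (simp add: sm)
  qed
qed

lemma module_quotient_module:
  assumes M: "module K M" and H: "submodule H K M"
  shows "module K (quotient_module M H)"
proof (rule module_epi_image[OF M coset_map_linear[OF M H] quotient_module_carrier])
  interpret M: module K M by fact
  have "H \<subseteq> carrier M" using H by (rule M.submoduleE)
  then show "\<zero>\<^bsub>quotient_module M H\<^esub> = H +>\<^bsub>M\<^esub> \<zero>\<^bsub>M\<^esub>"
    by (simp add: quotient_module_simps(2))
qed

section \<open>Tensor products and their universal property\<close>

definition bilinear ::
  "('k, 'm) ring_scheme \<Rightarrow> ('k, 'a, 'p) module_scheme \<Rightarrow> ('k, 'b, 'q) module_scheme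
    \<Rightarrow> ('k, 'c, 'r) module_scheme \<Rightarrow> ('a \<Rightarrow> 'b \<Rightarrow> 'c) \<Rightarrow> bool"
  where "bilinear K M N P B \<longleftrightarrow>
    (\<forall>y\<in>carrier N. (\<lambda>x. B x y) \<in> linear_hom K M P) \<and>
    (\<forall>x\<in>carrier M. (\<lambda>y. B x y) \<in> linear_hom K N P)"

lemma bilinearI:
  assumes "\<And>y. y \<in> carrier N \<Longrightarrow> (\<lambda>x. B x y) \<in> linear_hom K M P"
    and "\<And>x. x \<in> carrier M \<Longrightarrow> (\<lambda>y. B x y) \<in> linear_hom K N P"
  shows "bilinear K M N P B"
  using assms by (simp add: bilinear_def)

lemma bilinear_left:
  "bilinear K M N P B \<Longrightarrow> y \<in> carrier N \<Longrightarrow> (\<lambda>x. B x y) \<in> linear_hom K M P"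
  by (simp add: bilinear_def)

lemma bilinear_right:
  "bilinear K M N P B \<Longrightarrow> x \<in> carrier M \<Longrightarrow> (\<lambda>y. B x y) \<in> linear_hom K N P"
  by (simp add: bilinear_def)

lemma bilinear_closed:
  "bilinear K M N P B \<Longrightarrow> x \<in> carrier M \<Longrightarrow> y \<in> carrier N \<Longrightarrow> B x y \<in> carrier P"
  using linear_hom_closed[OF bilinear_left] .

lemma linear_comp_bilinear:
  assumes "bilinear K M N P B" "f \<in> linear_hom K P Q"
  shows "bilinear K M N Q (\<lambda>x y. f (B x y))"
  by (intro bilinearI linear_hom_compose[OF bilinear_left[OF assms(1)] assms(2)]
      linear_hom_compose[OF bilinear_right[OF assms(1)] assms(2)])

lemma module_cring: "module K M \<Longrightarrow> cring K"
  by (simp add: module_def)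

lemma tensor_rels_cases:
  assumes "r \<in> tensor_rels K M N"
  obtains
    (add_left) x x' y where
      "r = free_gen K (x \<oplus>\<^bsub>M\<^esub> x', y) \<ominus>\<^bsub>free_module K (carrier M \<times> carrier N)\<^esub>
        (free_gen K (x, y) \<oplus>\<^bsub>free_module K (carrier M \<times> carrier N)\<^esub> free_gen K (x', y))"
      "x \<in> carrier M" "x' \<in> carrier M" "y \<in> carrier N"
  | (add_right) x y y' where
      "r = free_gen K (x, y \<oplus>\<^bsub>N\<^esub> y') \<ominus>\<^bsub>free_module K (carrier M \<times> carrier N)\<^esub>
        (free_gen K (x, y) \<oplus>\<^bsub>free_module K (carrier M \<times> carrier N)\<^esub> free_gen K (x, y'))"
      "x \<in> carrier M" "y \<in> carrier N" "y' \<in> carrier N"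
  | (smult_left) a x y where
      "r = free_gen K (a \<odot>\<^bsub>M\<^esub> x, y) \<ominus>\<^bsub>free_module K (carrier M \<times> carrier N)\<^esub>
        (a \<odot>\<^bsub>free_module K (carrier M \<times> carrier N)\<^esub> free_gen K (x, y))"
      "a \<in> carrier K" "x \<in> carrier M" "y \<in> carrier N"
  | (smult_right) a x y where
      "r = free_gen K (x, a \<odot>\<^bsub>N\<^esub> y) \<ominus>\<^bsub>free_module K (carrier M \<times> carrier N)\<^esub>
        (a \<odot>\<^bsub>free_module K (carrier M \<times> carrier N)\<^esub> free_gen K (x, y))"
      "a \<in> carrier K" "x \<in> carrier M" "y \<in> carrier N"
  using assms unfolding tensor_rels_def Let_def
  apply (elim UnE CollectE exE conjE)
  subgoal by (rule that(1), assumption+)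
  subgoal by (rule that(2), assumption+)
  subgoal by (rule that(3), assumption+)
  subgoal by (rule that(4), assumption+)
  done

lemma tensor_rels_carrier:
  assumes M: "module K M" and N: "module K N"
  shows "tensor_rels K M N \<subseteq> carrier (free_module K (carrier M \<times> carrier N))"
proof
  interpret M: module K M by fact
  interpret N: module K N by fact
  note gen = free_gen_closed[OF M.is_cring, where I = "carrier M \<times> carrier N"]
  interpret F: module K "free_module K (carrier M \<times> carrier N)" by (rule module_free_module) (rule M.is_cring)
  fix r assume "r \<in> tensor_rels K M N"
  then show "r \<in> carrier (free_module K (carrier M \<times> carrier N))"
    by (cases rule: tensor_rels_cases)
       (auto intro!: gen)
qed

text \<open>The intersection defining the kernel is over a nonempty family, because the relations lie in the
free module itself.\<close>

lemma tensor_ker_submodule: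
  assumes M: "module K M" and N: "module K N"
  shows "submodule (tensor_ker K M N) K (free_module K (carrier M \<times> carrier N))"
proof -
  interpret M: module K M by fact
  interpret F: module K "free_module K (carrier M \<times> carrier N)" by (rule module_free_module) (rule M.is_cring)
  let ?S = "{H. submodule H K (free_module K (carrier M \<times> carrier N)) \<and> tensor_rels K M N \<subseteq> H}"
  have top: "carrier (free_module K (carrier M \<times> carrier N)) \<in> ?S"
    using F.carrier_is_submodule tensor_rels_carrier[OF M N] by auto
  show ?thesis
    unfolding tensor_ker_def
  proof (rule F.submoduleI)
    show "\<Inter>?S \<subseteq> carrier (free_module K (carrier M \<times> carrier N))" using top by blast
    show "\<zero>\<^bsub>free_module K (carrier M \<times> carrier N)\<^esub> \<in> \<Inter>?S"
      using subgroup.one_closed[OF submodule.axioms(1)] by fastforce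
  qed (auto dest: F.submoduleE(3,4,5))
qed

lemma tensor_rels_subset_ker: "tensor_rels K M N \<subseteq> tensor_ker K M N"
  unfolding tensor_ker_def by blast

text \<open>To show that a linear map kills the kernel it thus suffices to evaluate it on the four kinds of
relation.\<close>

lemma tensor_ker_least:
  "submodule H K (free_module K (carrier M \<times> carrier N)) \<Longrightarrow> tensor_rels K M N \<subseteq> H \<Longrightarrow>
    tensor_ker K M N \<subseteq> H"
  unfolding tensor_ker_def by blast

lemma module_tensor: "module K M \<Longrightarrow> module K N \<Longrightarrow> module K (tensor K M N)"
  unfolding tensor_def
  by (intro module_quotient_module module_free_module tensor_ker_submodule) (rule module_cring)

lemma pure_tensor_closed:
  assumes "module K M" "x \<in> carrier M" "y \<in> carrier N"
  shows "pure_tensor K M N x y \<in> carrier (tensor K M N)"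
  using assms free_gen_closed[OF module_cring[OF assms(1)], of "(x, y)" "carrier M \<times> carrier N"]
  by (auto simp: tensor_def pure_tensor_def quotient_module_carrier)

lemma tensor_rels_members:
  fixes K M N
  defines "F \<equiv> free_module K (carrier M \<times> carrier N)"
  shows "x \<in> carrier M \<Longrightarrow> x' \<in> carrier M \<Longrightarrow> y \<in> carrier N \<Longrightarrow>
      free_gen K (x \<oplus>\<^bsub>M\<^esub> x', y) \<ominus>\<^bsub>F\<^esub> (free_gen K (x, y) \<oplus>\<^bsub>F\<^esub> free_gen K (x', y))
        \<in> tensor_rels K M N"
    and "x \<in> carrier M \<Longrightarrow> y \<in> carrier N \<Longrightarrow> y' \<in> carrier N \<Longrightarrow>
      free_gen K (x, y \<oplus>\<^bsub>N\<^esub> y') \<ominus>\<^bsub>F\<^esub> (free_gen K (x, y) \<oplus>\<^bsub>F\<^esub> free_gen K (x, y'))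
        \<in> tensor_rels K M N"
    and "a \<in> carrier K \<Longrightarrow> x \<in> carrier M \<Longrightarrow> y \<in> carrier N \<Longrightarrow>
      free_gen K (a \<odot>\<^bsub>M\<^esub> x, y) \<ominus>\<^bsub>F\<^esub> a \<odot>\<^bsub>F\<^esub> free_gen K (x, y)
        \<in> tensor_rels K M N"
    and "a \<in> carrier K \<Longrightarrow> x \<in> carrier M \<Longrightarrow> y \<in> carrier N \<Longrightarrow>
      free_gen K (x, a \<odot>\<^bsub>N\<^esub> y) \<ominus>\<^bsub>F\<^esub> a \<odot>\<^bsub>F\<^esub> free_gen K (x, y)
        \<in> tensor_rels K M N"
  unfolding tensor_rels_def Let_def F_def by blast+

lemma pure_tensor_bilinear:
  assumes M: "module K M" and N: "module K N"
  shows "bilinear K M N (tensor K M N) (pure_tensor K M N)"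
proof -
  let ?F = "free_module K (carrier M \<times> carrier N)"
  interpret M: module K M by fact
  interpret N: module K N by fact
  interpret F: module K ?F by (rule module_free_module) (rule M.is_cring)
  note H = tensor_ker_submodule[OF M N]
  note lin = coset_map_linear[OF F.module_axioms H, folded tensor_def]
  note gen = free_gen_closed[OF M.is_cring, where I = "carrier M \<times> carrier N"]
  note eqI = coset_eq_iff[OF F.module_axioms H, THEN iffD2,
      OF _ _ tensor_rels_subset_ker[THEN subsetD]]
  show ?thesis
  proof (intro bilinearI linear_homI; (rule pure_tensor_closed[OF M])?)
    fix x x' y assume xy: "x \<in> carrier M" "x' \<in> carrier M" "y \<in> carrier N"
    have "pure_tensor K M N (x \<oplus>\<^bsub>M\<^esub> x') y
        = tensor_ker K M N +>\<^bsub>?F\<^esub> (free_gen K (x, y) \<oplus>\<^bsub>?F\<^esub> free_gen K (x', y))"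
      unfolding pure_tensor_def
      by (intro eqI tensor_rels_members gen F.add.m_closed F.smult_closed M.add.m_closed
          N.add.m_closed M.smult_closed N.smult_closed SigmaI xy)
    then show "pure_tensor K M N (x \<oplus>\<^bsub>M\<^esub> x') y
        = pure_tensor K M N x y \<oplus>\<^bsub>tensor K M N\<^esub> pure_tensor K M N x' y"
      using xy linear_hom_add[OF lin gen gen] by (simp add: pure_tensor_def)
  next
    fix x y y' assume xy: "x \<in> carrier M" "y \<in> carrier N" "y' \<in> carrier N"
    have "pure_tensor K M N x (y \<oplus>\<^bsub>N\<^esub> y')
        = tensor_ker K M N +>\<^bsub>?F\<^esub> (free_gen K (x, y) \<oplus>\<^bsub>?F\<^esub> free_gen K (x, y'))"
      unfolding pure_tensor_def
      by (intro eqI tensor_rels_members gen F.add.m_closed F.smult_closed M.add.m_closed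
          N.add.m_closed M.smult_closed N.smult_closed SigmaI xy)
    then show "pure_tensor K M N x (y \<oplus>\<^bsub>N\<^esub> y')
        = pure_tensor K M N x y \<oplus>\<^bsub>tensor K M N\<^esub> pure_tensor K M N x y'"
      using xy linear_hom_add[OF lin gen gen] by (simp add: pure_tensor_def)
  next
    fix a x y assume xy: "a \<in> carrier K" "x \<in> carrier M" "y \<in> carrier N"
    have "pure_tensor K M N (a \<odot>\<^bsub>M\<^esub> x) y
        = tensor_ker K M N +>\<^bsub>?F\<^esub> (a \<odot>\<^bsub>?F\<^esub> free_gen K (x, y))"
      unfolding pure_tensor_def
      by (intro eqI tensor_rels_members gen F.add.m_closed F.smult_closed M.add.m_closed
          N.add.m_closed M.smult_closed N.smult_closed SigmaI xy)
    then show "pure_tensor K M N (a \<odot>\<^bsub>M\<^esub> x) y = a \<odot>\<^bsub>tensor K M N\<^esub> pure_tensor K M N x y"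
      using xy linear_hom_smult[OF lin xy(1) gen] by (simp add: pure_tensor_def)
    have "pure_tensor K M N x (a \<odot>\<^bsub>N\<^esub> y)
        = tensor_ker K M N +>\<^bsub>?F\<^esub> (a \<odot>\<^bsub>?F\<^esub> free_gen K (x, y))"
      unfolding pure_tensor_def
      by (intro eqI tensor_rels_members gen F.add.m_closed F.smult_closed M.add.m_closed
          N.add.m_closed M.smult_closed N.smult_closed SigmaI xy)
    then show "pure_tensor K M N x (a \<odot>\<^bsub>N\<^esub> y) = a \<odot>\<^bsub>tensor K M N\<^esub> pure_tensor K M N x y"
      using xy linear_hom_smult[OF lin xy(1) gen] by (simp add: pure_tensor_def)
  qed
qed

text \<open>The zero set of the linear extension is a submodule, and bilinearity of \<open>B\<close> puts the defining
relations of the tensor product into it.\<close>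

lemma free_lift_vanishes_on_ker:
  assumes M: "module K M" and N: "module K N" and P: "module K P"
    and B: "bilinear K M N P B" and f: "f \<in> tensor_ker K M N"
  shows "free_lift K P (\<lambda>p. B (fst p) (snd p)) f = \<zero>\<^bsub>P\<^esub>"
proof -
  let ?F = "free_module K (carrier M \<times> carrier N)"
  let ?\<phi> = "free_lift K P (\<lambda>p. B (fst p) (snd p))"
  interpret M: module K M by fact
  interpret N: module K N by fact
  interpret P: module K P by fact
  interpret F: module K ?F by (rule module_free_module) (rule M.is_cring)
  note gen = free_gen_closed[OF M.is_cring, where I = "carrier M \<times> carrier N"]
  have cl: "B (fst p) (snd p) \<in> carrier P" if "p \<in> carrier M \<times> carrier N" for p
    using that bilinear_closed[OF B] by auto
  have lin: "?\<phi> \<in> linear_hom K ?F P" using cl by (rule free_lift_linear[OF P])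
  have val: "?\<phi> (free_gen K (x, y)) = B x y" if "x \<in> carrier M" "y \<in> carrier N" for x y
    using free_lift_gen[OF P cl, where i = "(x, y)"] that by simp
  note \<phi> = linear_hom_minus[OF F.module_axioms P lin] linear_hom_add[OF lin]
    linear_hom_smult[OF lin] val gen
  note Bl = bilinear_left[OF B] and Br = bilinear_right[OF B]
  have cancel: "u \<ominus>\<^bsub>P\<^esub> u = \<zero>\<^bsub>P\<^esub>" if "u \<in> carrier P" for u
    using that by (simp add: P.minus_eq P.r_neg)
  have "(\<lambda>f. \<zero>\<^bsub>P\<^esub>) \<in> linear_hom K ?F P"
    by (rule linear_homI) simp_all
  then have sub: "submodule {f \<in> carrier ?F. ?\<phi> f = \<zero>\<^bsub>P\<^esub>} K ?F"
    using equalizer_submodule[OF F.module_axioms P lin] by simp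
  have "?\<phi> r = \<zero>\<^bsub>P\<^esub>" if "r \<in> tensor_rels K M N" for r
    using that
  proof (cases rule: tensor_rels_cases)
    case (add_left x x' y)
    then show ?thesis
      by (simp add: \<phi> linear_hom_add[OF Bl] cancel bilinear_closed[OF B])
  next
    case (add_right x y y')
    then show ?thesis
      by (simp add: \<phi> linear_hom_add[OF Br] cancel bilinear_closed[OF B])
  next
    case (smult_left a x y)
    then show ?thesis
      by (simp add: \<phi> linear_hom_smult[OF Bl] cancel bilinear_closed[OF B])
  next
    case (smult_right a x y)
    then show ?thesis
      by (simp add: \<phi> linear_hom_smult[OF Br] cancel bilinear_closed[OF B])
  qed
  then have "tensor_rels K M N \<subseteq> {f \<in> carrier ?F. ?\<phi> f = \<zero>\<^bsub>P\<^esub>}"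
    using tensor_rels_carrier[OF M N] by blast
  then show ?thesis using tensor_ker_least[OF sub] f by blast
qed

lemma tensor_carrier:
  "carrier (tensor K M N)
    = (\<lambda>f. tensor_ker K M N +>\<^bsub>free_module K (carrier M \<times> carrier N)\<^esub> f)
        ` carrier (free_module K (carrier M \<times> carrier N))"
  by (simp add: tensor_def quotient_module_carrier)

text \<open>The value of \<^const>\<open>tensor_lift\<close> does not depend on the representative chosen inside it: two
representatives differ by an element of the kernel, on which the linear extension vanishes.\<close>

lemma tensor_lift_coset:
  assumes M: "module K M" and N: "module K N" and P: "module K P"
    and B: "bilinear K M N P B" and f: "f \<in> carrier (free_module K (carrier M \<times> carrier N))"
  shows "tensor_lift K P B (tensor_ker K M N +>\<^bsub>free_module K (carrier M \<times> carrier N)\<^esub> f)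
    = free_lift K P (\<lambda>p. B (fst p) (snd p)) f"
proof -
  let ?F = "free_module K (carrier M \<times> carrier N)"
  let ?\<phi> = "free_lift K P (\<lambda>p. B (fst p) (snd p))"
  let ?t = "tensor_ker K M N +>\<^bsub>?F\<^esub> f"
  interpret M: module K M by fact
  interpret P: module K P by fact
  interpret F: module K ?F by (rule module_free_module) (rule M.is_cring)
  interpret H: abelian_subgroup "tensor_ker K M N" ?F
    by (rule submodule_imp_abelian_subgroup[OF F.module_axioms tensor_ker_submodule[OF M N]])
  have lin: "?\<phi> \<in> linear_hom K ?F P"
    by (rule free_lift_linear[OF P]) (auto simp: bilinear_closed[OF B])
  define g where "g = (SOME g. g \<in> ?t)"
  have g: "g \<in> ?t" unfolding g_def by (rule someI[of _ f]) (rule H.a_rcos_self[OF f])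
  have gF: "g \<in> carrier ?F" by (rule H.a_elemrcos_carrier[OF f g])
  have "g \<ominus>\<^bsub>?F\<^esub> f \<in> tensor_ker K M N"
    using H.a_rcos_module[OF f gF] g by (simp add: F.minus_eq)
  then have "?\<phi> (g \<ominus>\<^bsub>?F\<^esub> f) = \<zero>\<^bsub>P\<^esub>"
    by (rule free_lift_vanishes_on_ker[OF M N P B])
  then have "?\<phi> (g \<ominus>\<^bsub>?F\<^esub> f \<oplus>\<^bsub>?F\<^esub> f) = ?\<phi> f"
    using linear_hom_add[OF lin F.minus_closed[OF gF f] f] linear_hom_closed[OF lin f] by simp
  then have "?\<phi> g = ?\<phi> f"
    using gF f by (simp add: F.minus_eq F.a_assoc F.l_neg)
  then show ?thesis
    by (simp add: tensor_lift_def free_lift_def g_def Let_def)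
qed

lemma tensor_lift_linear:
  assumes M: "module K M" and N: "module K N" and P: "module K P"
    and B: "bilinear K M N P B"
  shows "tensor_lift K P B \<in> linear_hom K (tensor K M N) P"
proof -
  let ?F = "free_module K (carrier M \<times> carrier N)"
  interpret M: module K M by fact
  interpret F: module K ?F by (rule module_free_module) (rule M.is_cring)
  have lin: "free_lift K P (\<lambda>p. B (fst p) (snd p)) \<in> linear_hom K ?F P"
    by (rule free_lift_linear[OF P]) (auto simp: bilinear_closed[OF B])
  note \<pi> = coset_map_linear[OF F.module_axioms tensor_ker_submodule[OF M N], folded tensor_def]
  note val = tensor_lift_coset[OF M N P B]
  note \<pi>_add = linear_hom_add[OF \<pi>, symmetric] and \<pi>_smult = linear_hom_smult[OF \<pi>, symmetric]
  show ?thesis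
    by (rule linear_homI; unfold tensor_carrier; elim imageE)
       (simp_all add: \<pi>_add \<pi>_smult val linear_hom_closed[OF lin] linear_hom_add[OF lin]
          linear_hom_smult[OF lin])
qed

lemma tensor_lift_pure:
  assumes M: "module K M" and N: "module K N" and P: "module K P"
    and B: "bilinear K M N P B" and x: "x \<in> carrier M" and y: "y \<in> carrier N"
  shows "tensor_lift K P B (pure_tensor K M N x y) = B x y"
proof -
  have K: "cring K" using M by (rule module_cring)
  have "tensor_lift K P B (pure_tensor K M N x y)
      = free_lift K P (\<lambda>p. B (fst p) (snd p)) (free_gen K (x, y))"
    unfolding pure_tensor_def using x y
    by (intro tensor_lift_coset[OF M N P B] free_gen_closed[OF K]) simp
  also have "\<dots> = B (fst (x, y)) (snd (x, y))"
    by (rule free_lift_gen[OF P, where I = "carrier M \<times> carrier N"])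
       (use x y in \<open>auto simp: bilinear_closed[OF B]\<close>)
  finally show ?thesis by simp
qed

text \<open>Uniqueness in the universal property: the pure tensors are the images of the free generators. All
later identities between linear maps are reduced to pure tensors by this lemma.\<close>

lemma linear_eq_on_tensor:
  assumes M: "module K M" and N: "module K N" and P: "module K P"
    and f: "f \<in> linear_hom K (tensor K M N) P" and g: "g \<in> linear_hom K (tensor K M N) P"
    and eq: "\<And>x y. x \<in> carrier M \<Longrightarrow> y \<in> carrier N \<Longrightarrow>
      f (pure_tensor K M N x y) = g (pure_tensor K M N x y)"
    and t: "t \<in> carrier (tensor K M N)"
  shows "f t = g t"
proof -
  let ?F = "free_module K (carrier M \<times> carrier N)"
  have K: "cring K" using M by (rule module_cring)
  have F: "module K ?F" using K by (rule module_free_module)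
  let ?\<pi> = "\<lambda>h. tensor_ker K M N +>\<^bsub>?F\<^esub> h"
  note \<pi> = coset_map_linear[OF F tensor_ker_submodule[OF M N], folded tensor_def]
  have sub: "submodule {h \<in> carrier ?F. f (?\<pi> h) = g (?\<pi> h)} K ?F"
    by (rule equalizer_submodule[OF F P linear_hom_compose[OF \<pi> f] linear_hom_compose[OF \<pi> g]])
  obtain h where h: "h \<in> carrier ?F" "t = ?\<pi> h" using t by (auto simp: tensor_carrier)
  have "h \<in> {h \<in> carrier ?F. f (?\<pi> h) = g (?\<pi> h)}"
    by (rule free_module_spanned_by_gens[OF K sub _ h(1)])
       (auto simp: free_gen_closed[OF K] eq[unfolded pure_tensor_def])
  then show ?thesis using h by simp
qed

text \<open>Read with \<open>t\<close> a coproduct, this is Sweedler notation: a linear map applied to an unknown tensor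
is computed as if the tensor were a sum of pure ones.\<close>

lemma linear_eq_tensor_lift:
  assumes M: "module K M" and N: "module K N" and P: "module K P"
    and f: "f \<in> linear_hom K (tensor K M N) P" and B: "bilinear K M N P B"
    and eq: "\<And>x y. x \<in> carrier M \<Longrightarrow> y \<in> carrier N \<Longrightarrow> f (pure_tensor K M N x y) = B x y"
    and t: "t \<in> carrier (tensor K M N)"
  shows "f t = tensor_lift K P B t"
  by (rule linear_eq_on_tensor[OF M N P f tensor_lift_linear[OF M N P B] _ t])
     (simp add: tensor_lift_pure[OF M N P B] eq)

lemma linear_of_tensor_lift:
  assumes M: "module K M" and N: "module K N" and P: "module K P" and Q: "module K Q"
    and B: "bilinear K M N P B" and f: "f \<in> linear_hom K P Q"
    and t: "t \<in> carrier (tensor K M N)"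
  shows "f (tensor_lift K P B t) = tensor_lift K Q (\<lambda>x y. f (B x y)) t"
proof -
  have B': "bilinear K M N Q (\<lambda>x y. f (B x y))"
    by (rule linear_comp_bilinear[OF B f])
  show ?thesis
    by (rule linear_eq_on_tensor[OF M N Q
          linear_hom_compose[OF tensor_lift_linear[OF M N P B] f]
          tensor_lift_linear[OF M N Q B'] _ t])
       (simp add: tensor_lift_pure[OF M N P B] tensor_lift_pure[OF M N Q B'])
qed

lemma tensor_lift_cong:
  assumes M: "module K M" and N: "module K N" and P: "module K P"
    and B: "bilinear K M N P B" and t: "t \<in> carrier (tensor K M N)"
    and eq: "\<And>x y. x \<in> carrier M \<Longrightarrow> y \<in> carrier N \<Longrightarrow> B x y = B' x y"
  shows "tensor_lift K P B t = tensor_lift K P B' t"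
proof -
  interpret M: module K M by fact
  interpret N: module K N by fact
  have "bilinear K M N P B'"
  by (intro bilinearI linear_homI)
    (use eq bilinear_closed[OF B] linear_hom_add[OF bilinear_left[OF B]]
      linear_hom_add[OF bilinear_right[OF B]] linear_hom_smult[OF bilinear_left[OF B]]
      linear_hom_smult[OF bilinear_right[OF B]] in \<open>simp_all add: eq[symmetric]\<close>)
  then show ?thesis
    using linear_eq_on_tensor[OF M N P tensor_lift_linear[OF M N P B] tensor_lift_linear[OF M N P]
        _ t, of B']
    by (simp add: tensor_lift_pure[OF M N P] B eq)
qed

text \<open>Linearity in a parameter of the integrand. For fixed parameters both sides of the linearity
equations are linear in \<open>t\<close>, so it is enough to see them for pure \<open>t\<close>, where the lift is
just \<open>B x a b\<close>.\<close>

lemma tensor_lift_linear_param: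
  assumes M: "module K M" and N: "module K N" and P: "module K P" and L: "module K L"
    and lin: "\<And>a b. a \<in> carrier M \<Longrightarrow> b \<in> carrier N \<Longrightarrow> (\<lambda>x. B x a b) \<in> linear_hom K L P"
    and B: "\<And>x. x \<in> carrier L \<Longrightarrow> bilinear K M N P (B x)"
    and t: "t \<in> carrier (tensor K M N)"
  shows "(\<lambda>x. tensor_lift K P (B x) t) \<in> linear_hom K L P"
proof -
  interpret L: module K L by fact
  have lift: "tensor_lift K P (B x) \<in> linear_hom K (tensor K M N) P" if "x \<in> carrier L" for x
    by (rule tensor_lift_linear[OF M N P B[OF that]])
  have val: "tensor_lift K P (B x) (pure_tensor K M N a b) = B x a b"
    if "x \<in> carrier L" "a \<in> carrier M" "b \<in> carrier N" for x a b
    by (rule tensor_lift_pure[OF M N P B]) fact+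
  show ?thesis
  proof (rule linear_homI)
    fix x assume x: "x \<in> carrier L"
    then show "tensor_lift K P (B x) t \<in> carrier P" by (rule linear_hom_closed[OF lift t])
    fix y assume y: "y \<in> carrier L"
    show "tensor_lift K P (B (x \<oplus>\<^bsub>L\<^esub> y)) t
        = tensor_lift K P (B x) t \<oplus>\<^bsub>P\<^esub> tensor_lift K P (B y) t"
      by (rule linear_eq_on_tensor[OF M N P lift[OF L.add.m_closed[OF x y]]
            linear_hom_sum[OF P lift[OF x] lift[OF y]] _ t])
         (simp add: val x y linear_hom_add[OF lin])
  next
    fix a x assume a: "a \<in> carrier K" and x: "x \<in> carrier L"
    show "tensor_lift K P (B (a \<odot>\<^bsub>L\<^esub> x)) t = a \<odot>\<^bsub>P\<^esub> tensor_lift K P (B x) t"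
      by (rule linear_eq_on_tensor[OF M N P lift[OF L.smult_closed[OF a x]]
            linear_hom_scaled[OF P lift[OF x] a] _ t])
         (simp add: val a x linear_hom_smult[OF lin])
  qed
qed

text \<open>The exchange of two finite sums, in terms of lifts. Both sides are linear in \<open>s\<close> and agree for
pure \<open>s\<close>.\<close>

lemma tensor_lift_commute:
  assumes M: "module K M" and N: "module K N" and M': "module K M'" and N': "module K N'"
    and P: "module K P"
    and B: "\<And>a b. a \<in> carrier M \<Longrightarrow> b \<in> carrier N \<Longrightarrow> bilinear K M' N' P (B a b)"
    and C: "\<And>c d. c \<in> carrier M' \<Longrightarrow> d \<in> carrier N' \<Longrightarrow> bilinear K M N P (\<lambda>a b. B a b c d)"
    and s: "s \<in> carrier (tensor K M' N')" and t: "t \<in> carrier (tensor K M N)"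
  shows "tensor_lift K P (\<lambda>a b. tensor_lift K P (B a b) s) t
    = tensor_lift K P (\<lambda>c d. tensor_lift K P (\<lambda>a b. B a b c d) t) s"
proof -
  have inner: "bilinear K M' N' P (\<lambda>c d. tensor_lift K P (\<lambda>a b. B a b c d) t)"
    by (intro bilinearI tensor_lift_linear_param[OF M N P M'] tensor_lift_linear_param[OF M N P N']
        bilinear_left[OF B] bilinear_right[OF B] C t)
  have outer: "bilinear K M N P (\<lambda>a b. tensor_lift K P (B a b) s)" if "s \<in> carrier (tensor K M' N')" for s
    by (intro bilinearI tensor_lift_linear_param[OF M' N' P M] tensor_lift_linear_param[OF M' N' P N]
        bilinear_left[OF C] bilinear_right[OF C] B that)
  have lin: "(\<lambda>s. tensor_lift K P (\<lambda>a b. tensor_lift K P (B a b) s) t)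
      \<in> linear_hom K (tensor K M' N') P"
    by (intro tensor_lift_linear_param[OF M N P module_tensor[OF M' N']]
        tensor_lift_linear[OF M' N' P] B outer t)
  show ?thesis
  proof (rule linear_eq_on_tensor[OF M' N' P lin tensor_lift_linear[OF M' N' P inner] _ s])
    fix c d assume cd: "c \<in> carrier M'" "d \<in> carrier N'"
    show "tensor_lift K P (\<lambda>a b. tensor_lift K P (B a b) (pure_tensor K M' N' c d)) t
        = tensor_lift K P (\<lambda>c d. tensor_lift K P (\<lambda>a b. B a b c d) t) (pure_tensor K M' N' c d)"
      unfolding tensor_lift_pure[OF M' N' P inner cd]
      by (rule tensor_lift_cong[OF M N P outer t])
         (use cd in \<open>auto intro: tensor_lift_pure[OF M' N' P B] pure_tensor_closed[OF M']\<close>)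
  qed
qed

lemma linear_eq_on_triple_tensor:
  assumes L: "module K L" and M: "module K M" and N: "module K N" and P: "module K P"
    and f: "f \<in> linear_hom K (tensor K (tensor K L M) N) P"
    and g: "g \<in> linear_hom K (tensor K (tensor K L M) N) P"
    and eq: "\<And>x y z. x \<in> carrier L \<Longrightarrow> y \<in> carrier M \<Longrightarrow> z \<in> carrier N \<Longrightarrow>
      f (pure_tensor K (tensor K L M) N (pure_tensor K L M x y) z)
        = g (pure_tensor K (tensor K L M) N (pure_tensor K L M x y) z)"
    and t: "t \<in> carrier (tensor K (tensor K L M) N)"
  shows "f t = g t"
proof (rule linear_eq_on_tensor[OF module_tensor[OF L M] N P f g _ t])
  fix s z assume s: "s \<in> carrier (tensor K L M)" and z: "z \<in> carrier N"
  note \<iota> = bilinear_left[OF pure_tensor_bilinear[OF module_tensor[OF L M] N] z]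
  show "f (pure_tensor K (tensor K L M) N s z) = g (pure_tensor K (tensor K L M) N s z)"
    by (rule linear_eq_on_tensor[OF L M P linear_hom_compose[OF \<iota> f] linear_hom_compose[OF \<iota> g] _ s])
       (rule eq[OF _ _ z])
qed

section \<open>The structure maps of the tensor product\<close>

lemma pure_tensor_linear_left:
  assumes "module K M" "module K N" "f \<in> linear_hom K L M" "y \<in> carrier N"
  shows "(\<lambda>x. pure_tensor K M N (f x) y) \<in> linear_hom K L (tensor K M N)"
  by (rule linear_hom_compose[OF assms(3) bilinear_left[OF pure_tensor_bilinear[OF assms(1,2)] assms(4)]])

lemma pure_tensor_linear_right:
  assumes "module K M" "module K N" "f \<in> linear_hom K L N" "x \<in> carrier M"
  shows "(\<lambda>y. pure_tensor K M N x (f y)) \<in> linear_hom K L (tensor K M N)"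
  by (rule linear_hom_compose[OF assms(3) bilinear_right[OF pure_tensor_bilinear[OF assms(1,2)] assms(4)]])

lemma tensor_map:
  assumes M: "module K M" and N: "module K N" and P: "module K P" and Q: "module K Q"
    and f: "f \<in> linear_hom K M P" and g: "g \<in> linear_hom K N Q"
  shows tensor_map_linear: "tensor_map K P Q f g \<in> linear_hom K (tensor K M N) (tensor K P Q)"
    and tensor_map_pure: "\<And>x y. x \<in> carrier M \<Longrightarrow> y \<in> carrier N \<Longrightarrow>
      tensor_map K P Q f g (pure_tensor K M N x y) = pure_tensor K P Q (f x) (g y)"
proof -
  have B: "bilinear K M N (tensor K P Q) (\<lambda>x y. pure_tensor K P Q (f x) (g y))"
    by (intro bilinearI pure_tensor_linear_left[OF P Q f] pure_tensor_linear_right[OF P Q g]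
        linear_hom_closed[OF f] linear_hom_closed[OF g])
  note PQ = module_tensor[OF P Q]
  show "tensor_map K P Q f g \<in> linear_hom K (tensor K M N) (tensor K P Q)"
    unfolding tensor_map_def by (rule tensor_lift_linear[OF M N PQ B])
  show "tensor_map K P Q f g (pure_tensor K M N x y) = pure_tensor K P Q (f x) (g y)"
    if "x \<in> carrier M" "y \<in> carrier N" for x y
    unfolding tensor_map_def by (rule tensor_lift_pure[OF M N PQ B that])
qed

lemma tensor_flip:
  assumes M: "module K M" and N: "module K N"
  shows tensor_flip_linear: "tensor_flip K M N \<in> linear_hom K (tensor K M N) (tensor K N M)"
    and tensor_flip_pure: "\<And>x y. x \<in> carrier M \<Longrightarrow> y \<in> carrier N \<Longrightarrow>
      tensor_flip K M N (pure_tensor K M N x y) = pure_tensor K N M y x"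
proof -
  have B: "bilinear K M N (tensor K N M) (\<lambda>x y. pure_tensor K N M y x)"
    by (intro bilinearI pure_tensor_linear_left[OF N M linear_hom_ident]
        pure_tensor_linear_right[OF N M linear_hom_ident])
  note NM = module_tensor[OF N M]
  show "tensor_flip K M N \<in> linear_hom K (tensor K M N) (tensor K N M)"
    unfolding tensor_flip_def by (rule tensor_lift_linear[OF M N NM B])
  show "tensor_flip K M N (pure_tensor K M N x y) = pure_tensor K N M y x"
    if "x \<in> carrier M" "y \<in> carrier N" for x y
    unfolding tensor_flip_def by (rule tensor_lift_pure[OF M N NM B that])
qed

lemma tensor_assoc:
  assumes L: "module K L" and M: "module K M" and N: "module K N"
  shows tensor_assoc_linear: "tensor_assoc K L M N
      \<in> linear_hom K (tensor K (tensor K L M) N) (tensor K L (tensor K M N))"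
    and tensor_assoc_pure: "\<And>x y z. x \<in> carrier L \<Longrightarrow> y \<in> carrier M \<Longrightarrow> z \<in> carrier N \<Longrightarrow>
      tensor_assoc K L M N (pure_tensor K (tensor K L M) N (pure_tensor K L M x y) z)
        = pure_tensor K L (tensor K M N) x (pure_tensor K M N y z)"
proof -
  note LM = module_tensor[OF L M] and MN = module_tensor[OF M N]
  note T = module_tensor[OF L MN]
  let ?T = "tensor K L (tensor K M N)"
  let ?b = "\<lambda>z x y. pure_tensor K L (tensor K M N) x (pure_tensor K M N y z)"
  have b: "bilinear K L M ?T (?b z)" if "z \<in> carrier N" for z
    by (intro bilinearI pure_tensor_linear_left[OF L MN linear_hom_ident]
        pure_tensor_linear_right[OF L MN] pure_tensor_linear_left[OF M N linear_hom_ident]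
        pure_tensor_closed[OF M] that)
  have B: "bilinear K (tensor K L M) N ?T (\<lambda>t z. tensor_lift K ?T (?b z) t)"
    by (intro bilinearI tensor_lift_linear[OF L M T] tensor_lift_linear_param[OF L M T N] b
        pure_tensor_linear_right[OF L MN] pure_tensor_linear_right[OF M N linear_hom_ident])
  show "tensor_assoc K L M N \<in> linear_hom K (tensor K (tensor K L M) N) ?T"
    unfolding tensor_assoc_def Let_def by (rule tensor_lift_linear[OF LM N T B])
  show "tensor_assoc K L M N (pure_tensor K (tensor K L M) N (pure_tensor K L M x y) z) = ?b z x y"
    if "x \<in> carrier L" "y \<in> carrier M" "z \<in> carrier N" for x y z
    using that unfolding tensor_assoc_def Let_def
    by (simp add: tensor_lift_pure[OF LM N T B] tensor_lift_pure[OF L M T b] pure_tensor_closed[OF L])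
qed

lemma tensor_unassoc:
  assumes L: "module K L" and M: "module K M" and N: "module K N"
  shows tensor_unassoc_linear: "tensor_unassoc K L M N
      \<in> linear_hom K (tensor K L (tensor K M N)) (tensor K (tensor K L M) N)"
    and tensor_unassoc_pure: "\<And>x y z. x \<in> carrier L \<Longrightarrow> y \<in> carrier M \<Longrightarrow> z \<in> carrier N \<Longrightarrow>
      tensor_unassoc K L M N (pure_tensor K L (tensor K M N) x (pure_tensor K M N y z))
        = pure_tensor K (tensor K L M) N (pure_tensor K L M x y) z"
proof -
  note LM = module_tensor[OF L M] and MN = module_tensor[OF M N]
  note T = module_tensor[OF LM N]
  let ?T = "tensor K (tensor K L M) N"
  let ?b = "\<lambda>x y z. pure_tensor K (tensor K L M) N (pure_tensor K L M x y) z"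
  have b: "bilinear K M N ?T (?b x)" if "x \<in> carrier L" for x
    by (intro bilinearI pure_tensor_linear_right[OF LM N linear_hom_ident]
        pure_tensor_linear_left[OF LM N] pure_tensor_linear_right[OF L M linear_hom_ident]
        pure_tensor_closed[OF L] that)
  have B: "bilinear K L (tensor K M N) ?T (\<lambda>x t. tensor_lift K ?T (?b x) t)"
    by (intro bilinearI tensor_lift_linear[OF M N T] tensor_lift_linear_param[OF M N T L] b
        pure_tensor_linear_left[OF LM N] pure_tensor_linear_left[OF L M linear_hom_ident])
  show "tensor_unassoc K L M N \<in> linear_hom K (tensor K L (tensor K M N)) ?T"
    unfolding tensor_unassoc_def Let_def by (rule tensor_lift_linear[OF L MN T B])
  show "tensor_unassoc K L M N (pure_tensor K L (tensor K M N) x (pure_tensor K M N y z)) = ?b x y z"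
    if "x \<in> carrier L" "y \<in> carrier M" "z \<in> carrier N" for x y z
    using that unfolding tensor_unassoc_def Let_def
    by (simp add: tensor_lift_pure[OF L MN T B] tensor_lift_pure[OF M N T b] pure_tensor_closed[OF M])
qed

section \<open>Sweedler calculus\<close>

text \<open>Writing \<open>x \<triangleleft> y\<close> for \<open>q (x \<otimes> y)\<close>, self-distributivity reads
\<open>(x \<triangleleft> y) \<triangleleft> z = (x \<triangleleft> z\<^sub>1) \<triangleleft> (y \<triangleleft> z\<^sub>2)\<close>, which is the law of a shelf with the
diagonal replaced by the comultiplication.\<close>

locale cocommutative_shelf = cocommutative_coalgebra K X \<Delta> \<epsilon>
  for K (structure) and X (structure) and \<Delta> and \<epsilon> +
  fixes q
  assumes q_linear: "q \<in> linear_hom K (tensor K X X) X"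
    and q_self_distributive: "self_distributive K X \<Delta> q"
    and q_comult_compatible: "comult_compatible K X \<Delta> q"
begin

abbreviation "XX \<equiv> tensor K X X"
abbreviation "XXX \<equiv> tensor K XX X"

abbreviation tens2 (infixr "\<boxtimes>" 65)
  where "x \<boxtimes> y \<equiv> pure_tensor K X X x y"

abbreviation tens3
  where "tens3 x y z \<equiv> pure_tensor K XX X (x \<boxtimes> y) z"

abbreviation shelf_op (infixl "\<triangleleft>" 70)
  where "x \<triangleleft> y \<equiv> q (x \<boxtimes> y)"

text \<open>\<open>sweedler P (\<lambda>a b. B a b) x\<close> stands for the sum of \<open>B x\<^sub>1 x\<^sub>2\<close> in Sweedler notation, with
values in \<open>P\<close>.\<close>

abbreviation sweedler
  where "sweedler P B x \<equiv> tensor_lift K P B (\<Delta> x)"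

lemmas X = module_axioms
lemmas XX = module_tensor[OF X X]
lemmas XXX = module_tensor[OF XX X]
lemmas X_XX = module_tensor[OF X XX]
lemmas XX_XX = module_tensor[OF XX XX]

lemma comult_closed: "x \<in> carrier X \<Longrightarrow> \<Delta> x \<in> carrier XX"
  by (rule linear_hom_closed[OF comult_linear])

lemma tens2_closed: "x \<in> carrier X \<Longrightarrow> y \<in> carrier X \<Longrightarrow> x \<boxtimes> y \<in> carrier XX"
  by (rule pure_tensor_closed[OF X])

lemma shelf_op_closed: "x \<in> carrier X \<Longrightarrow> y \<in> carrier X \<Longrightarrow> x \<triangleleft> y \<in> carrier X"
  by (rule linear_hom_closed[OF q_linear tens2_closed])

lemma sweedler_linear_arg:
  assumes "module K P" "bilinear K X X P B" "f \<in> linear_hom K L X"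
  shows "(\<lambda>x. sweedler P B (f x)) \<in> linear_hom K L P"
  by (rule linear_hom_compose[OF linear_hom_compose[OF assms(3) comult_linear]
        tensor_lift_linear[OF X X assms(1,2)]])

lemma sweedler_linear_param:
  assumes "module K P" "module K L"
    and "\<And>a b. a \<in> carrier X \<Longrightarrow> b \<in> carrier X \<Longrightarrow> (\<lambda>x. B x a b) \<in> linear_hom K L P"
    and "\<And>x. x \<in> carrier L \<Longrightarrow> bilinear K X X P (B x)"
    and "c \<in> carrier X"
  shows "(\<lambda>x. sweedler P (B x) c) \<in> linear_hom K L P"
  using assms by (intro tensor_lift_linear_param[OF X X] comult_closed)

text \<open>These rules decide by the shape of an expression that it is linear or bilinear in the variables
bound in it. Every expression of the later computations uses each of its variables once, so exactly
one linearity rule applies at each step and backward chaining succeeds.\<close>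

lemmas multilinear =
  bilinearI linear_hom_ident linear_hom_compose[OF _ q_linear]
  pure_tensor_linear_left[OF X X] pure_tensor_linear_left[OF XX X]
  pure_tensor_linear_right[OF X X] pure_tensor_linear_right[OF XX X]
  sweedler_linear_arg sweedler_linear_param X XX XXX
  shelf_op_closed tens2_closed

lemma sweedler_cong:
  assumes "module K P" "bilinear K X X P B" "x \<in> carrier X"
    and "\<And>a b. a \<in> carrier X \<Longrightarrow> b \<in> carrier X \<Longrightarrow> B a b = B' a b"
  shows "sweedler P B x = sweedler P B' x"
  using assms by (intro tensor_lift_cong[OF X X] comult_closed)

lemma linear_of_sweedler:
  assumes P: "module K P" and Q: "module K Q" and B: "bilinear K X X P B"
    and f: "f \<in> linear_hom K P Q" and x: "x \<in> carrier X"
    and eq: "\<And>a b. a \<in> carrier X \<Longrightarrow> b \<in> carrier X \<Longrightarrow> f (B a b) = C a b"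
  shows "f (sweedler P B x) = sweedler Q C x"
  using linear_of_tensor_lift[OF X X P Q B f comult_closed[OF x]]
    sweedler_cong[OF Q linear_comp_bilinear[OF B f] x eq] by simp

lemma sweedler_commute:
  assumes "module K P"
    and "\<And>a b. a \<in> carrier X \<Longrightarrow> b \<in> carrier X \<Longrightarrow> bilinear K X X P (B a b)"
    and "\<And>c d. c \<in> carrier X \<Longrightarrow> d \<in> carrier X \<Longrightarrow> bilinear K X X P (\<lambda>a b. B a b c d)"
    and "x \<in> carrier X" "y \<in> carrier X"
  shows "sweedler P (\<lambda>a b. sweedler P (B a b) y) x
    = sweedler P (\<lambda>c d. sweedler P (\<lambda>a b. B a b c d) x) y"
  using assms by (intro tensor_lift_commute[OF X X X X] comult_closed)

lemma sweedler_cocommutative: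
  assumes P: "module K P" and B: "bilinear K X X P B" and x: "x \<in> carrier X"
  shows "sweedler P B x = sweedler P (\<lambda>a b. B b a) x"
proof -
  have B': "bilinear K X X P (\<lambda>a b. B b a)"
    using B by (simp add: bilinear_def)
  have "tensor_lift K P B (tensor_flip K X X (\<Delta> x)) = tensor_lift K P (\<lambda>a b. B b a) (\<Delta> x)"
    by (rule linear_eq_tensor_lift[OF X X P
          linear_hom_compose[OF tensor_flip_linear[OF X X] tensor_lift_linear[OF X X P B]]
          B' _ comult_closed[OF x]])
       (simp add: tensor_flip_pure[OF X X] tensor_lift_pure[OF X X P B])
  then show ?thesis by (simp add: cocommutative[OF x])
qed

text \<open>Being linear in each argument, \<open>T\<close> extends to a linear map \<open>G\<close> on \<open>X \<otimes> (X \<otimes> X)\<close>,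
and the two sides are \<open>G\<close> applied to the two sides of the coassociativity axiom.\<close>

lemma sweedler_coassociative:
  assumes P: "module K P" and x: "x \<in> carrier X"
    and T12: "\<And>c. c \<in> carrier X \<Longrightarrow> bilinear K X X P (\<lambda>a b. T a b c)"
    and T23: "\<And>a. a \<in> carrier X \<Longrightarrow> bilinear K X X P (T a)"
  shows "sweedler P (\<lambda>u c. sweedler P (\<lambda>a b. T a b c) u) x
    = sweedler P (\<lambda>a u. sweedler P (T a) u) x"
proof -
  define G where "G = tensor_lift K P (\<lambda>a. tensor_lift K P (T a))"
  have inner: "bilinear K X XX P (\<lambda>a. tensor_lift K P (T a))"
    by (intro bilinearI tensor_lift_linear[OF X X P T23] tensor_lift_linear_param[OF X X P X]
        T23 bilinear_left[OF T12])
  have G: "G \<in> linear_hom K (tensor K X XX) P"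
    unfolding G_def by (rule tensor_lift_linear[OF X XX P inner])
  have G_pure: "G (pure_tensor K X XX a t) = tensor_lift K P (T a) t"
    if "a \<in> carrier X" "t \<in> carrier XX" for a t
    unfolding G_def by (rule tensor_lift_pure[OF X XX P inner that])
  note id_comult = tensor_map_linear[OF X X X XX linear_hom_id comult_linear]
    tensor_map_pure[OF X X X XX linear_hom_id comult_linear]
  note comult_id = tensor_map_linear[OF X X XX X comult_linear linear_hom_id]
    tensor_map_pure[OF X X XX X comult_linear linear_hom_id]
  have right: "bilinear K X X P (\<lambda>a. sweedler P (T a))"
    by (intro bilinearI sweedler_linear_arg[OF P T23 linear_hom_ident]
        sweedler_linear_param[OF P X] T23 bilinear_left[OF T12])
  have left: "bilinear K X X P (\<lambda>u c. sweedler P (\<lambda>a b. T a b c) u)"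
    by (intro bilinearI sweedler_linear_arg[OF P T12 linear_hom_ident]
        sweedler_linear_param[OF P X] T12 bilinear_right[OF T23])
  have G_assoc: "G (tensor_assoc K X X X (pure_tensor K XX X t c)) = tensor_lift K P (\<lambda>a b. T a b c) t"
    if c: "c \<in> carrier X" and t: "t \<in> carrier XX" for t c
    by (rule linear_eq_tensor_lift[OF X X P
          linear_hom_compose[OF linear_hom_compose[OF
            pure_tensor_linear_left[OF XX X linear_hom_ident c] tensor_assoc_linear[OF X X X]] G]
          T12[OF c] _ t])
       (simp add: tensor_assoc_pure[OF X X X] c G_pure tens2_closed tensor_lift_pure[OF X X P T23])
  have "G (tensor_map K X XX id \<Delta> (\<Delta> x)) = sweedler P (\<lambda>a u. sweedler P (T a) u) x"
    by (rule linear_eq_tensor_lift[OF X X P linear_hom_compose[OF id_comult(1) G] right _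
          comult_closed[OF x]])
       (simp add: id_comult(2) G_pure comult_closed)
  moreover have "G (tensor_assoc K X X X (tensor_map K XX X \<Delta> id (\<Delta> x)))
      = sweedler P (\<lambda>u c. sweedler P (\<lambda>a b. T a b c) u) x"
    by (rule linear_eq_tensor_lift[OF X X P linear_hom_compose[OF
            linear_hom_compose[OF comult_id(1) tensor_assoc_linear[OF X X X]] G] left _
          comult_closed[OF x]])
       (simp add: comult_id(2) G_assoc comult_closed)
  ultimately show ?thesis by (simp add: coassociative[OF x])
qed

text \<open>The fourfold coproduct \<open>x\<^sub>1 \<otimes> x\<^sub>2 \<otimes> x\<^sub>3 \<otimes> x\<^sub>4\<close>, obtained here as \<open>(\<Delta> \<otimes> \<Delta>) \<Delta>\<close>, is unchanged when
\<open>x\<^sub>2\<close> and \<open>x\<^sub>3\<close> are exchanged. Coassociativity rebrackets it so that the two middle factors are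
the coproduct of a single factor, and cocommutativity flips that coproduct.\<close>

lemma sweedler_swap_middle:
  assumes P: "module K P" and x: "x \<in> carrier X"
    and Q12: "\<And>c d. c \<in> carrier X \<Longrightarrow> d \<in> carrier X \<Longrightarrow> bilinear K X X P (\<lambda>a b. Q a b c d)"
    and Q23: "\<And>a d. a \<in> carrier X \<Longrightarrow> d \<in> carrier X \<Longrightarrow> bilinear K X X P (\<lambda>b c. Q a b c d)"
    and Q34: "\<And>a b. a \<in> carrier X \<Longrightarrow> b \<in> carrier X \<Longrightarrow> bilinear K X X P (\<lambda>c d. Q a b c d)"
  shows "sweedler P (\<lambda>u v. sweedler P (\<lambda>a b. sweedler P (\<lambda>c d. Q a b c d) v) u) x
    = sweedler P (\<lambda>u v. sweedler P (\<lambda>a b. sweedler P (\<lambda>c d. Q a c b d) v) u) x"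
proof -
  note lin = bilinear_left[OF Q12] bilinear_right[OF Q12] bilinear_right[OF Q23] bilinear_right[OF Q34]
  have reassoc: "sweedler P (\<lambda>u v. sweedler P (\<lambda>a b. sweedler P (\<lambda>c d. Q' a b c d) v) u) x
      = sweedler P (\<lambda>a u. sweedler P (\<lambda>v d. sweedler P (\<lambda>b c. Q' a b c d) v) u) x"
    if lin: "\<And>b c d. b \<in> carrier X \<Longrightarrow> c \<in> carrier X \<Longrightarrow> d \<in> carrier X \<Longrightarrow> (\<lambda>a. Q' a b c d) \<in> linear_hom K X P"
      "\<And>a c d. a \<in> carrier X \<Longrightarrow> c \<in> carrier X \<Longrightarrow> d \<in> carrier X \<Longrightarrow> (\<lambda>b. Q' a b c d) \<in> linear_hom K X P"
      "\<And>a b d. a \<in> carrier X \<Longrightarrow> b \<in> carrier X \<Longrightarrow> d \<in> carrier X \<Longrightarrow> (\<lambda>c. Q' a b c d) \<in> linear_hom K X P"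
      "\<And>a b c. a \<in> carrier X \<Longrightarrow> b \<in> carrier X \<Longrightarrow> c \<in> carrier X \<Longrightarrow> (\<lambda>d. Q' a b c d) \<in> linear_hom K X P"
    for Q'
  proof -
    have "sweedler P (\<lambda>u v. sweedler P (\<lambda>a b. sweedler P (\<lambda>c d. Q' a b c d) v) u) x
        = sweedler P (\<lambda>a u. sweedler P (\<lambda>b v. sweedler P (\<lambda>c d. Q' a b c d) v) u) x"
      by (rule sweedler_coassociative[OF P x]) (auto intro!: multilinear lin P)
    also have "\<dots> = sweedler P (\<lambda>a u. sweedler P (\<lambda>v d. sweedler P (\<lambda>b c. Q' a b c d) v) u) x"
      by (intro sweedler_cong[OF P _ x] sweedler_coassociative[OF P, symmetric])
         (auto intro!: multilinear lin P)
    finally show ?thesis .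
  qed
  have "sweedler P (\<lambda>u v. sweedler P (\<lambda>a b. sweedler P (\<lambda>c d. Q a b c d) v) u) x
      = sweedler P (\<lambda>a u. sweedler P (\<lambda>v d. sweedler P (\<lambda>b c. Q a b c d) v) u) x"
    by (rule reassoc) (simp_all add: lin)
  also have "\<dots> = sweedler P (\<lambda>a u. sweedler P (\<lambda>v d. sweedler P (\<lambda>b c. Q a c b d) v) u) x"
    by (intro sweedler_cong[OF P _ x] sweedler_cong[OF P] sweedler_cocommutative[OF P])
       (auto intro!: multilinear lin P)
  also have "\<dots> = sweedler P (\<lambda>u v. sweedler P (\<lambda>a b. sweedler P (\<lambda>c d. Q a c b d) v) u) x"
    by (rule reassoc[symmetric]) (simp_all add: lin)
  finally show ?thesis .
qed

section \<open>Self-distributivity and compatibility in Sweedler form\<close>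

lemma middle_flip:
  shows middle_flip_linear: "tensor_middle_flip K X \<in> linear_hom K (tensor K XX XX) (tensor K XX XX)"
    and middle_flip_pure: "\<And>a b c d. a \<in> carrier X \<Longrightarrow> b \<in> carrier X \<Longrightarrow> c \<in> carrier X \<Longrightarrow>
      d \<in> carrier X \<Longrightarrow> tensor_middle_flip K X (pure_tensor K XX XX (a \<boxtimes> b) (c \<boxtimes> d))
        = pure_tensor K XX XX (a \<boxtimes> c) (b \<boxtimes> d)"
proof -
  let ?swap = "\<lambda>t. tensor_assoc K X X X (tensor_map K XX X (tensor_flip K X X) id (tensor_unassoc K X X X t))"
  note map_flip = tensor_map[OF XX X XX X tensor_flip_linear[OF X X] linear_hom_id]
  have swap: "?swap \<in> linear_hom K (tensor K X XX) (tensor K X XX)"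
    by (rule linear_hom_compose[OF linear_hom_compose[OF
          tensor_unassoc_linear[OF X X X] map_flip(1)] tensor_assoc_linear[OF X X X]])
  note map_swap = tensor_map[OF X X_XX X X_XX linear_hom_id swap]
  have eq: "tensor_middle_flip K X = (\<lambda>t. tensor_unassoc K X X XX
      (tensor_map K X (tensor K X XX) id ?swap (tensor_assoc K X X XX t)))"
    by (simp add: tensor_middle_flip_def Let_def comp_def)
  show "tensor_middle_flip K X \<in> linear_hom K (tensor K XX XX) (tensor K XX XX)"
    unfolding eq by (rule linear_hom_compose[OF linear_hom_compose[OF
          tensor_assoc_linear[OF X X XX] map_swap(1)] tensor_unassoc_linear[OF X X XX]])
  show "tensor_middle_flip K X (pure_tensor K XX XX (a \<boxtimes> b) (c \<boxtimes> d))
      = pure_tensor K XX XX (a \<boxtimes> c) (b \<boxtimes> d)"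
    if "a \<in> carrier X" "b \<in> carrier X" "c \<in> carrier X" "d \<in> carrier X" for a b c d
    using that unfolding eq
    by (simp add: tensor_assoc_pure[OF X X XX] tensor_assoc_pure[OF X X X]
        tensor_unassoc_pure[OF X X X] tensor_unassoc_pure[OF X X XX] map_flip(2) map_swap(2)
        tensor_flip_pure[OF X X] tens2_closed pure_tensor_closed[OF X])
qed

text \<open>The composite \<open>(q \<otimes> q)(1 \<otimes> \<tau> \<otimes> 1)\<close>, shared by the two axioms on \<open>q\<close>.\<close>

lemma q_q_middle_flip:
  shows q_q_middle_flip_linear: "(\<lambda>t. tensor_map K X X q q (tensor_middle_flip K X t))
      \<in> linear_hom K (tensor K XX XX) XX"
    and q_q_middle_flip_pure: "\<And>a b c d. a \<in> carrier X \<Longrightarrow> b \<in> carrier X \<Longrightarrow> c \<in> carrier X \<Longrightarrow>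
      d \<in> carrier X \<Longrightarrow>
      tensor_map K X X q q (tensor_middle_flip K X (pure_tensor K XX XX (a \<boxtimes> b) (c \<boxtimes> d)))
        = (a \<triangleleft> c) \<boxtimes> (b \<triangleleft> d)"
proof -
  note qq = tensor_map[OF XX XX X X q_linear q_linear]
  show "(\<lambda>t. tensor_map K X X q q (tensor_middle_flip K X t)) \<in> linear_hom K (tensor K XX XX) XX"
    by (rule linear_hom_compose[OF middle_flip_linear qq(1)])
  show "tensor_map K X X q q (tensor_middle_flip K X (pure_tensor K XX XX (a \<boxtimes> b) (c \<boxtimes> d)))
      = (a \<triangleleft> c) \<boxtimes> (b \<triangleleft> d)"
    if "a \<in> carrier X" "b \<in> carrier X" "c \<in> carrier X" "d \<in> carrier X" for a b c d
    using that by (simp add: middle_flip_pure qq(2) tens2_closed)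
qed

lemma sweedler_self_distributive:
  assumes x: "x \<in> carrier X" and y: "y \<in> carrier X" and z: "z \<in> carrier X"
  shows "(x \<triangleleft> y) \<triangleleft> z = sweedler X (\<lambda>a b. (x \<triangleleft> a) \<triangleleft> (y \<triangleleft> b)) z"
proof -
  let ?D = "\<lambda>t. q (tensor_map K X X q q (tensor_middle_flip K X t))"
  note q_id = tensor_map_pure[OF XX X X X q_linear linear_hom_id]
  note id_comult = tensor_map_pure[OF XX X XX XX linear_hom_id comult_linear]
  have "tens3 x y z \<in> carrier XXX"
    by (rule pure_tensor_closed[OF XX tens2_closed[OF x y] z])
  then have "q (tensor_map K X X q id (tens3 x y z)) = ?D (tensor_map K XX XX id \<Delta> (tens3 x y z))"
    using q_self_distributive by (simp add: self_distributive_def Let_def)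
  then have "(x \<triangleleft> y) \<triangleleft> z = ?D (pure_tensor K XX XX (x \<boxtimes> y) (\<Delta> z))"
    using x y z by (simp add: q_id id_comult tens2_closed)
  also have "\<dots> = sweedler X (\<lambda>a b. (x \<triangleleft> a) \<triangleleft> (y \<triangleleft> b)) z"
    by (rule linear_eq_tensor_lift[OF X X X linear_hom_compose[OF
            pure_tensor_linear_right[OF XX XX linear_hom_ident tens2_closed[OF x y]]
            linear_hom_compose[OF q_q_middle_flip_linear q_linear]] _ _ comult_closed[OF z]])
       (use x y in \<open>auto intro!: multilinear simp: q_q_middle_flip_pure\<close>)
  finally show ?thesis .
qed

text \<open>Compatibility with the comultiplication, \<open>\<Delta> (x \<triangleleft> y) = (x\<^sub>1 \<triangleleft> y\<^sub>1) \<otimes> (x\<^sub>2 \<triangleleft> y\<^sub>2)\<close>, in the form in which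
it rewrites a Sweedler sum.\<close>

lemma sweedler_shelf_op:
  assumes P: "module K P" and B: "bilinear K X X P B" and x: "x \<in> carrier X" and y: "y \<in> carrier X"
  shows "sweedler P B (x \<triangleleft> y)
    = sweedler P (\<lambda>a b. sweedler P (\<lambda>c d. B (a \<triangleleft> c) (b \<triangleleft> d)) y) x"
proof -
  let ?G = "\<lambda>t. tensor_lift K P B (tensor_map K X X q q (tensor_middle_flip K X t))"
  have G: "?G \<in> linear_hom K (tensor K XX XX) P"
    by (rule linear_hom_compose[OF q_q_middle_flip_linear tensor_lift_linear[OF X X P B]])
  have Q: "(\<lambda>a. B (a \<triangleleft> c) e) \<in> linear_hom K X P" "(\<lambda>c. B (a \<triangleleft> c) e) \<in> linear_hom K X P"
    "(\<lambda>b. B e (b \<triangleleft> d)) \<in> linear_hom K X P" "(\<lambda>d. B e (b \<triangleleft> d)) \<in> linear_hom K X P"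
    if "a \<in> carrier X" "b \<in> carrier X" "c \<in> carrier X" "d \<in> carrier X" "e \<in> carrier X" for a b c d e
    using that
    by (auto intro!: multilinear linear_hom_compose[OF _ bilinear_left[OF B]]
        linear_hom_compose[OF _ bilinear_right[OF B]])
  have G_left: "?G (pure_tensor K XX XX (a \<boxtimes> b) (\<Delta> y)) = sweedler P (\<lambda>c d. B (a \<triangleleft> c) (b \<triangleleft> d)) y"
    if a: "a \<in> carrier X" and b: "b \<in> carrier X" for a b
    by (rule linear_eq_tensor_lift[OF X X P linear_hom_compose[OF
            pure_tensor_linear_right[OF XX XX linear_hom_ident tens2_closed[OF a b]] G]
            _ _ comult_closed[OF y]])
       (use a b in \<open>auto intro!: bilinearI Q
          simp: q_q_middle_flip_pure tensor_lift_pure[OF X X P B] shelf_op_closed\<close>)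
  have "(x \<boxtimes> y) \<in> carrier XX" by (rule tens2_closed[OF x y])
  then have "\<Delta> (x \<triangleleft> y)
      = tensor_map K X X q q (tensor_middle_flip K X (tensor_map K XX XX \<Delta> \<Delta> (x \<boxtimes> y)))"
    using q_comult_compatible by (simp add: comult_compatible_def Let_def)
  then have "sweedler P B (x \<triangleleft> y) = ?G (pure_tensor K XX XX (\<Delta> x) (\<Delta> y))"
    using x y by (simp add: tensor_map_pure[OF X X XX XX comult_linear comult_linear])
  also have "\<dots> = sweedler P (\<lambda>a b. sweedler P (\<lambda>c d. B (a \<triangleleft> c) (b \<triangleleft> d)) y) x"
    by (rule linear_eq_tensor_lift[OF X X P linear_hom_compose[OF
            pure_tensor_linear_left[OF XX XX linear_hom_ident comult_closed[OF y]] G]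
            _ _ comult_closed[OF x]])
       (use y in \<open>auto intro!: bilinearI sweedler_linear_param P X Q shelf_op_closed simp: G_left\<close>)
  finally show ?thesis .
qed

section \<open>The two sides of the Yang--Baxter equation\<close>

abbreviation R where "R \<equiv> induced_R K X \<Delta> q"
abbreviation R12 where "R12 \<equiv> tensor_map K XX X R id"
abbreviation R23
  where "R23 t \<equiv> tensor_unassoc K X X X (tensor_map K X XX id R (tensor_assoc K X X X t))"

lemma R_linear_and_pure:
  shows R_linear: "R \<in> linear_hom K XX XX"
    and R_pure: "\<And>x y. x \<in> carrier X \<Longrightarrow> y \<in> carrier X \<Longrightarrow>
      R (x \<boxtimes> y) = sweedler XX (\<lambda>a b. a \<boxtimes> (x \<triangleleft> b)) y"
proof -
  note map_flip = tensor_map[OF XX X XX X tensor_flip_linear[OF X X] linear_hom_id]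
  note id_q = tensor_map[OF X XX X X linear_hom_id q_linear]
  note id_comult = tensor_map[OF X X X XX linear_hom_id comult_linear]
  let ?S = "\<lambda>t. tensor_map K X X id q (tensor_assoc K X X X
      (tensor_map K XX X (tensor_flip K X X) id (tensor_unassoc K X X X t)))"
  have R: "R = (\<lambda>t. ?S (tensor_map K X XX id \<Delta> t))"
    by (simp add: induced_R_def Let_def comp_def)
  have S: "?S \<in> linear_hom K (tensor K X XX) XX"
    by (rule linear_hom_compose[OF linear_hom_compose[OF linear_hom_compose[OF
          tensor_unassoc_linear[OF X X X] map_flip(1)] tensor_assoc_linear[OF X X X]] id_q(1)])
  show "R \<in> linear_hom K XX XX"
    unfolding R by (rule linear_hom_compose[OF id_comult(1) S])
  fix x y assume x: "x \<in> carrier X" and y: "y \<in> carrier X"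
  have "R (x \<boxtimes> y) = ?S (pure_tensor K X XX x (\<Delta> y))"
    using x y by (simp add: R id_comult(2))
  also have "\<dots> = sweedler XX (\<lambda>a b. a \<boxtimes> (x \<triangleleft> b)) y"
    by (rule linear_eq_tensor_lift[OF X X XX linear_hom_compose[OF
            pure_tensor_linear_right[OF X XX linear_hom_ident x] S] _ _ comult_closed[OF y]])
       (use x in \<open>auto intro!: multilinear simp: tensor_unassoc_pure[OF X X X] map_flip(2)
          tensor_flip_pure[OF X X] tensor_assoc_pure[OF X X X] id_q(2) tens2_closed\<close>)
  finally show "R (x \<boxtimes> y) = sweedler XX (\<lambda>a b. a \<boxtimes> (x \<triangleleft> b)) y" .
qed

lemma R12_linear_and_pure:
  shows R12_linear: "R12 \<in> linear_hom K XXX XXX"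
    and R12_pure: "\<And>x y z. x \<in> carrier X \<Longrightarrow> y \<in> carrier X \<Longrightarrow> z \<in> carrier X \<Longrightarrow>
      R12 (tens3 x y z) = sweedler XXX (\<lambda>a b. tens3 a (x \<triangleleft> b) z) y"
proof -
  note R_id = tensor_map[OF XX X XX X R_linear linear_hom_id]
  show "R12 \<in> linear_hom K XXX XXX" by (rule R_id(1))
  fix x y z assume x: "x \<in> carrier X" and y: "y \<in> carrier X" and z: "z \<in> carrier X"
  have "R12 (tens3 x y z) = pure_tensor K XX X (sweedler XX (\<lambda>a b. a \<boxtimes> (x \<triangleleft> b)) y) z"
    using x y z by (simp add: R_id(2) R_pure tens2_closed)
  also have "\<dots> = sweedler XXX (\<lambda>a b. tens3 a (x \<triangleleft> b) z) y"
    by (rule linear_of_sweedler[OF XX XXX _ pure_tensor_linear_left[OF XX X linear_hom_ident z] y])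
       (use x in \<open>auto intro!: multilinear\<close>)
  finally show "R12 (tens3 x y z) = sweedler XXX (\<lambda>a b. tens3 a (x \<triangleleft> b) z) y" .
qed

lemma R23_linear_and_pure:
  shows R23_linear: "(\<lambda>t. R23 t) \<in> linear_hom K XXX XXX"
    and R23_pure: "\<And>x y z. x \<in> carrier X \<Longrightarrow> y \<in> carrier X \<Longrightarrow> z \<in> carrier X \<Longrightarrow>
      R23 (tens3 x y z) = sweedler XXX (\<lambda>a b. tens3 x a (y \<triangleleft> b)) z"
proof -
  note id_R = tensor_map[OF X XX X XX linear_hom_id R_linear]
  show "(\<lambda>t. R23 t) \<in> linear_hom K XXX XXX"
    by (rule linear_hom_compose[OF linear_hom_compose[OF tensor_assoc_linear[OF X X X] id_R(1)]
          tensor_unassoc_linear[OF X X X]])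
  fix x y z assume x: "x \<in> carrier X" and y: "y \<in> carrier X" and z: "z \<in> carrier X"
  have "R23 (tens3 x y z)
      = tensor_unassoc K X X X (pure_tensor K X XX x (sweedler XX (\<lambda>a b. a \<boxtimes> (y \<triangleleft> b)) z))"
    using x y z by (simp add: tensor_assoc_pure[OF X X X] id_R(2) R_pure tens2_closed)
  also have "\<dots> = sweedler XXX (\<lambda>a b. tens3 x a (y \<triangleleft> b)) z"
    by (rule linear_of_sweedler[OF XX XXX _ linear_hom_compose[OF
            pure_tensor_linear_right[OF X XX linear_hom_ident x] tensor_unassoc_linear[OF X X X]] z])
       (use x y in \<open>auto intro!: multilinear simp: tensor_unassoc_pure[OF X X X] shelf_op_closed\<close>)
  finally show "R23 (tens3 x y z) = sweedler XXX (\<lambda>a b. tens3 x a (y \<triangleleft> b)) z" .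
qed

text \<open>In Sweedler notation the left-hand side is \<open>z\<^sub>1 \<otimes> (y\<^sub>1 \<triangleleft> z\<^sub>2) \<otimes> ((x \<triangleleft> y\<^sub>2) \<triangleleft> z\<^sub>3)\<close>. Self-distributivity
splits \<open>z\<^sub>3\<close> in the last factor and yields
\<open>z\<^sub>1 \<otimes> (y\<^sub>1 \<triangleleft> z\<^sub>2) \<otimes> ((x \<triangleleft> z\<^sub>3) \<triangleleft> (y\<^sub>2 \<triangleleft> z\<^sub>4))\<close>.\<close>

lemma R12_R23_R12_pure:
  assumes x: "x \<in> carrier X" and y: "y \<in> carrier X" and z: "z \<in> carrier X"
  shows "R12 (R23 (R12 (tens3 x y z)))
    = sweedler XXX (\<lambda>a b. sweedler XXX (\<lambda>u v. sweedler XXX (\<lambda>c d. sweedler XXX (\<lambda>e f.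
        tens3 c (a \<triangleleft> d) ((x \<triangleleft> e) \<triangleleft> (b \<triangleleft> f))) v) u) z) y"
proof -
  have last: "tens3 c (a \<triangleleft> d) ((x \<triangleleft> b) \<triangleleft> v)
      = sweedler XXX (\<lambda>e f. tens3 c (a \<triangleleft> d) ((x \<triangleleft> e) \<triangleleft> (b \<triangleleft> f))) v"
    if "a \<in> carrier X" "b \<in> carrier X" "c \<in> carrier X" "d \<in> carrier X" "v \<in> carrier X" for a b c d v
    unfolding sweedler_self_distributive[OF x that(2) that(5)]
    by (rule linear_of_sweedler[OF X XXX _ pure_tensor_linear_right[OF XX X linear_hom_ident]])
       (use x that in \<open>auto intro!: multilinear\<close>)
  have r12: "R12 (tens3 a u ((x \<triangleleft> b) \<triangleleft> v)) = sweedler XXX (\<lambda>c d. sweedler XXX (\<lambda>e f.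
        tens3 c (a \<triangleleft> d) ((x \<triangleleft> e) \<triangleleft> (b \<triangleleft> f))) v) u"
    if "a \<in> carrier X" "b \<in> carrier X" "u \<in> carrier X" "v \<in> carrier X" for a b u v
  proof -
    have "R12 (tens3 a u ((x \<triangleleft> b) \<triangleleft> v)) = sweedler XXX (\<lambda>c d. tens3 c (a \<triangleleft> d) ((x \<triangleleft> b) \<triangleleft> v)) u"
      using that x by (simp add: R12_pure shelf_op_closed)
    also have "\<dots> = sweedler XXX (\<lambda>c d. sweedler XXX (\<lambda>e f.
        tens3 c (a \<triangleleft> d) ((x \<triangleleft> e) \<triangleleft> (b \<triangleleft> f))) v) u"
      by (rule sweedler_cong[OF XXX _ that(3) last])
         (use that x in \<open>auto intro!: multilinear\<close>)
    finally show ?thesis .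
  qed
  have first_two: "R23 (R12 (tens3 x y z))
      = sweedler XXX (\<lambda>a b. sweedler XXX (\<lambda>u v. tens3 a u ((x \<triangleleft> b) \<triangleleft> v)) z) y"
    unfolding R12_pure[OF x y z]
    by (rule linear_of_sweedler[OF XXX XXX _ R23_linear y])
       (use x z in \<open>auto intro!: multilinear simp: R23_pure shelf_op_closed\<close>)
  show ?thesis
    unfolding first_two
  proof (rule linear_of_sweedler[OF XXX XXX _ R12_linear y])
    show "bilinear K X X XXX (\<lambda>a b. sweedler XXX (\<lambda>u v. tens3 a u ((x \<triangleleft> b) \<triangleleft> v)) z)"
      using x z by (auto intro!: multilinear)
    fix a b assume ab: "a \<in> carrier X" "b \<in> carrier X"
    show "R12 (sweedler XXX (\<lambda>u v. tens3 a u ((x \<triangleleft> b) \<triangleleft> v)) z)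
        = sweedler XXX (\<lambda>u v. sweedler XXX (\<lambda>c d. sweedler XXX (\<lambda>e f.
            tens3 c (a \<triangleleft> d) ((x \<triangleleft> e) \<triangleleft> (b \<triangleleft> f))) v) u) z"
      by (rule linear_of_sweedler[OF XXX XXX _ R12_linear z r12[OF ab]])
         (use x ab in \<open>auto intro!: multilinear\<close>)
  qed
qed

text \<open>Here the coproduct of \<open>y \<triangleleft> z\<^sub>3\<close> appears. Compatibility splits it and yields
\<open>z\<^sub>1 \<otimes> (y\<^sub>1 \<triangleleft> z\<^sub>3) \<otimes> ((x \<triangleleft> z\<^sub>2) \<triangleleft> (y\<^sub>2 \<triangleleft> z\<^sub>4))\<close>, which differs from the other side only in the order
of \<open>z\<^sub>2\<close> and \<open>z\<^sub>3\<close>.\<close>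

lemma R23_R12_R23_pure:
  assumes x: "x \<in> carrier X" and y: "y \<in> carrier X" and z: "z \<in> carrier X"
  shows "R23 (R12 (R23 (tens3 x y z)))
    = sweedler XXX (\<lambda>u v. sweedler XXX (\<lambda>c d. sweedler XXX (\<lambda>a b. sweedler XXX (\<lambda>e f.
        tens3 c (a \<triangleleft> e) ((x \<triangleleft> d) \<triangleleft> (b \<triangleleft> f))) v) y) u) z"
proof -
  have r23: "R23 (tens3 c (x \<triangleleft> d) (y \<triangleleft> v)) = sweedler XXX (\<lambda>a b. sweedler XXX (\<lambda>e f.
        tens3 c (a \<triangleleft> e) ((x \<triangleleft> d) \<triangleleft> (b \<triangleleft> f))) v) y"
    if "c \<in> carrier X" "d \<in> carrier X" "v \<in> carrier X" for c d v
  proof -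
    have "R23 (tens3 c (x \<triangleleft> d) (y \<triangleleft> v))
        = sweedler XXX (\<lambda>a b. tens3 c a ((x \<triangleleft> d) \<triangleleft> b)) (y \<triangleleft> v)"
      using that x y by (simp add: R23_pure shelf_op_closed)
    also have "\<dots> = sweedler XXX (\<lambda>a b. sweedler XXX (\<lambda>e f.
        tens3 c (a \<triangleleft> e) ((x \<triangleleft> d) \<triangleleft> (b \<triangleleft> f))) v) y"
      by (rule sweedler_shelf_op[OF XXX _ y that(3)])
         (use that x in \<open>auto intro!: multilinear\<close>)
    finally show ?thesis .
  qed
  have r12: "R12 (tens3 x u (y \<triangleleft> v)) = sweedler XXX (\<lambda>c d. tens3 c (x \<triangleleft> d) (y \<triangleleft> v)) u"
    if "u \<in> carrier X" "v \<in> carrier X" for u v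
    using that x y by (simp add: R12_pure shelf_op_closed)
  have first_two: "R12 (R23 (tens3 x y z))
      = sweedler XXX (\<lambda>u v. sweedler XXX (\<lambda>c d. tens3 c (x \<triangleleft> d) (y \<triangleleft> v)) u) z"
    unfolding R23_pure[OF x y z]
    by (rule linear_of_sweedler[OF XXX XXX _ R12_linear z])
       (use x y in \<open>auto intro!: multilinear simp: r12\<close>)
  show ?thesis
    unfolding first_two
  proof (rule linear_of_sweedler[OF XXX XXX _ R23_linear z])
    show "bilinear K X X XXX (\<lambda>u v. sweedler XXX (\<lambda>c d. tens3 c (x \<triangleleft> d) (y \<triangleleft> v)) u)"
      using x y by (auto intro!: multilinear)
    fix u v assume uv: "u \<in> carrier X" "v \<in> carrier X"
    show "R23 (sweedler XXX (\<lambda>c d. tens3 c (x \<triangleleft> d) (y \<triangleleft> v)) u)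
        = sweedler XXX (\<lambda>c d. sweedler XXX (\<lambda>a b. sweedler XXX (\<lambda>e f.
            tens3 c (a \<triangleleft> e) ((x \<triangleleft> d) \<triangleleft> (b \<triangleleft> f))) v) y) u"
      by (rule linear_of_sweedler[OF XXX XXX _ R23_linear uv(1)])
         (use x y uv in \<open>auto intro!: multilinear simp: r23\<close>)
  qed
qed

text \<open>The two normal forms differ by the exchange of \<open>z\<^sub>2\<close> and \<open>z\<^sub>3\<close>; what remains is to move the
summation over the coproduct of \<open>y\<close> past those over the coproducts of \<open>z\<close> and of its first
part.\<close>

lemma yang_baxter_pure:
  assumes x: "x \<in> carrier X" and y: "y \<in> carrier X" and z: "z \<in> carrier X"
  shows "R12 (R23 (R12 (tens3 x y z))) = R23 (R12 (R23 (tens3 x y z)))"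
proof -
  let ?Q = "\<lambda>a b c d e f. tens3 c (a \<triangleleft> d) ((x \<triangleleft> e) \<triangleleft> (b \<triangleleft> f))"
  have "R12 (R23 (R12 (tens3 x y z)))
      = sweedler XXX (\<lambda>a b. sweedler XXX (\<lambda>u v. sweedler XXX (\<lambda>c d. sweedler XXX (\<lambda>e f.
          ?Q a b c d e f) v) u) z) y"
    by (rule R12_R23_R12_pure[OF x y z])
  \<comment> \<open>\<open>c, d\<close> and \<open>e, f\<close> are the parts of the two halves \<open>u, v\<close> of \<open>z\<close>; the inner two are exchanged.\<close>
  also have "\<dots> = sweedler XXX (\<lambda>a b. sweedler XXX (\<lambda>u v. sweedler XXX (\<lambda>c d. sweedler XXX (\<lambda>e f.
          ?Q a b c e d f) v) u) z) y"
    by (intro sweedler_cong[OF XXX _ y] sweedler_swap_middle[OF XXX z])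
       (use x z in \<open>auto intro!: multilinear\<close>)
  also have "\<dots> = sweedler XXX (\<lambda>u v. sweedler XXX (\<lambda>a b. sweedler XXX (\<lambda>c d. sweedler XXX (\<lambda>e f.
          ?Q a b c e d f) v) u) y) z"
    by (intro sweedler_commute[OF XXX _ _ y z])
       (use x in \<open>auto intro!: multilinear\<close>)
  also have "\<dots> = sweedler XXX (\<lambda>u v. sweedler XXX (\<lambda>c d. sweedler XXX (\<lambda>a b. sweedler XXX (\<lambda>e f.
          ?Q a b c e d f) v) y) u) z"
    by (intro sweedler_cong[OF XXX _ z] sweedler_commute[OF XXX _ _ y])
       (use x y in \<open>auto intro!: multilinear\<close>)
  also have "\<dots> = R23 (R12 (R23 (tens3 x y z)))"
    by (rule R23_R12_R23_pure[OF x y z, symmetric])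
  finally show ?thesis .
qed

lemma yang_baxter_induced_R: "yang_baxter K X R"
proof -
  have "R12 (R23 (R12 t)) = R23 (R12 (R23 t))" if "t \<in> carrier XXX" for t
    by (rule linear_eq_on_triple_tensor[OF X X X XXX
          linear_hom_compose[OF linear_hom_compose[OF R12_linear R23_linear] R12_linear]
          linear_hom_compose[OF linear_hom_compose[OF R23_linear R12_linear] R23_linear]
          yang_baxter_pure that])
  then show ?thesis by (simp add: yang_baxter_def Let_def)
qed

end

theorem theorem4p3:
  fixes K :: "('k, 'm) ring_scheme"
    and X :: "('k, 'x, 'p) module_scheme"
    and \<Delta> :: "'x \<Rightarrow> ('x \<times> 'x \<Rightarrow> 'k) set"
    and \<epsilon> :: "'x \<Rightarrow> 'k"
    and q :: "('x \<times> 'x \<Rightarrow> 'k) set \<Rightarrow> 'x"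
  assumes "cocommutative_coalgebra K X \<Delta> \<epsilon>"
    and "q \<in> linear_hom K (tensor K X X) X"
    and "self_distributive K X \<Delta> q"
    and "comult_compatible K X \<Delta> q"
  shows "yang_baxter K X (induced_R K X \<Delta> q)"
proof -
  interpret cocommutative_shelf K X \<Delta> \<epsilon> q
    using assms by (intro cocommutative_shelf.intro cocommutative_shelf_axioms.intro)
  show ?thesis by (rule yang_baxter_induced_R)
qed

end
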